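(* Let $X$ be an infinite, connected, locally finite, vertex-transitive graph, and let $(X_n)$ be an increasing sequence of finite induced subgraphs of $X$ whose union is $X$. (a) If $(X_n)$ is a Følner sequence (i.e. $\inf_n|\partial X_n|/|X_n|=0$), then both the cumulative spectral measures $\tilde\mu_n$ (of simple random walk on $X_n$) and $\tilde\mu_{|n}$ (of the truncation to $X_n$ of the simple random walk operator $P$ of $X$) converge weakly to the Plancherel measure of $X$. (b) If $(X_n)$ is an expanding sequence (i.e. $\inf_n|\partial X_n|/|X_n|>0$), then $\tilde\mu_{|n}$ does not converge to the Plancherel measure of $X$.
   Context: For a graph in which every vertex has at least one and finitely many neighbours, simple random walk (SRW) has transition probabilities $p(x,y)=1/\deg(x)$ if $y\sim x$ (neighbours) and $0$ otherwise. $P$ denotes the SRW operator $Pf(x)=\sum_y p(x,y)f(y)$ on $X$, self-adjoint on $\ell^2(X)$ (as $X$ is regular). The Plancherel measure of $X$ is the probability measure $\mu_{o,o}(d\lambda)=\langle\delta_o,E(d\lambda)\delta_o\rangle$, with $E$ the resolution of the identity of $P$; by transitivity it does not depend on the vertex $o$, and its $N$-th moment is the return probability $p^{(N)}(o,o)$ (an entry of $P^N$). Induced means: two vertices of $X_n$ that are neighbours in $X$ are also neighbours in $X_n$. The boundary is $\partial X_n=\{x\in X_n: x \text{ has a neighbour in } X\setminus X_n\}$. $P_n$ is the SRW operator on the graph $X_n$ (using the degrees in $X_n$); when $\tilde\mu_n$ is considered it is understood that SRW on $X_n$ is defined, i.e. every vertex of $X_n$ has a neighbour in $X_n$. $P_{|n}$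 is the truncation of $P$ to $X_n$, i.e. the matrix $(p(x,y))_{x,y\in X_n}$. The cumulative spectral measures are $$\tilde\mu_n=\frac1{|X_n|}\sum_{\lambda\in\mathrm{spec}(P_n)}\mathrm{mult}(\lambda)\,\delta_\lambda,\qquad \tilde\mu_{|n}=\frac1{|X_n|}\sum_{\lambda\in\mathrm{spec}(P_{|n})}\mathrm{mult}(\lambda)\,\delta_\lambda,$$ where $\mathrm{mult}(\lambda)$ is the multiplicity of the eigenvalue $\lambda$ of the respective operator.
   Formalization: In (a), convergence of the whole sequences is stated when |∂X_n|/|X_n| tends to 0; under inf_n |∂X_n|/|X_n| = 0 alone it is stated only along a subsequence, since the full claim then fails (boxes in Z^2 alternating with boxes plus long paths). *)

theory Defs
  imports "HOL-Probability.Probability" "HOL-Library.Function_Algebras"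
begin

text \<open>
  A simple graph is given by its adjacency relation; its vertex set is the whole type \<open>'v\<close>.
  An induced subgraph is given by its vertex set.
\<close>

definition simple_graph :: "('v \<Rightarrow> 'v \<Rightarrow> bool) \<Rightarrow> bool" where
  "simple_graph adj \<longleftrightarrow> symp adj \<and> irreflp adj"

definition locally_finite_graph :: "('v \<Rightarrow> 'v \<Rightarrow> bool) \<Rightarrow> bool" where
  "locally_finite_graph adj \<longleftrightarrow> (\<forall>x. finite {y. adj x y})"

definition connected_graph :: "('v \<Rightarrow> 'v \<Rightarrow> bool) \<Rightarrow> bool" where
  "connected_graph adj \<longleftrightarrow> (\<forall>x y. adj\<^sup>*\<^sup>* x y)"

definition graph_automorphism :: "('v \<Rightarrow> 'v \<Rightarrow> bool) \<Rightarrow> ('v \<Rightarrow> 'v) \<Rightarrow> bool" where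
  "graph_automorphism adj \<phi> \<longleftrightarrow> bij \<phi> \<and> (\<forall>x y. adj (\<phi> x) (\<phi> y) \<longleftrightarrow> adj x y)"

definition vertex_transitive :: "('v \<Rightarrow> 'v \<Rightarrow> bool) \<Rightarrow> bool" where
  "vertex_transitive adj \<longleftrightarrow> (\<forall>x y. \<exists>\<phi>. graph_automorphism adj \<phi> \<and> \<phi> x = y)"

definition vertex_boundary :: "('v \<Rightarrow> 'v \<Rightarrow> bool) \<Rightarrow> 'v set \<Rightarrow> 'v set" where
  "vertex_boundary adj W = {x \<in> W. \<exists>y. y \<notin> W \<and> adj x y}"

definition boundary_ratio :: "('v \<Rightarrow> 'v \<Rightarrow> bool) \<Rightarrow> 'v set \<Rightarrow> real" where
  "boundary_ratio adj W = real (card (vertex_boundary adj W)) / real (card W)"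

text \<open>SRW is defined on the subgraph induced on \<open>W\<close>.\<close>

definition no_isolated :: "('v \<Rightarrow> 'v \<Rightarrow> bool) \<Rightarrow> 'v set \<Rightarrow> bool" where
  "no_isolated adj W \<longleftrightarrow> (\<forall>x\<in>W. \<exists>y\<in>W. adj x y)"

text \<open>
  Transition probabilities of SRW on the subgraph induced on \<open>W\<close>; \<open>W = UNIV\<close> is the whole graph.
\<close>

definition srw :: "('v \<Rightarrow> 'v \<Rightarrow> bool) \<Rightarrow> 'v set \<Rightarrow> 'v \<Rightarrow> 'v \<Rightarrow> real" where
  "srw adj W x y =
     (if x \<in> W \<and> y \<in> W \<and> adj x y then 1 / real (card {z \<in> W. adj x z}) else 0)"

text \<open>
  Eigenspaces of a matrix \<open>K\<close> with index set \<open>W\<close>. Vectors indexed by \<open>W\<close> are functions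
  vanishing off \<open>W\<close>. Only real eigenvalues are collected: the matrices below are self-adjoint
  with respect to a positive weight (the vertex degree), so there are no others, and the
  multiplicity of an eigenvalue is the dimension of its eigenspace.
\<close>

definition eigenspace :: "'v set \<Rightarrow> ('v \<Rightarrow> 'v \<Rightarrow> real) \<Rightarrow> real \<Rightarrow> ('v \<Rightarrow> real) set" where
  "eigenspace W K t =
     {f. (\<forall>x. x \<notin> W \<longrightarrow> f x = 0) \<and> (\<forall>x\<in>W. (\<Sum>y\<in>W. K x y * f y) = t * f x)}"

definition spec :: "'v set \<Rightarrow> ('v \<Rightarrow> 'v \<Rightarrow> real) \<Rightarrow> real set" where
  "spec W K = {t. \<exists>f \<in> eigenspace W K t. \<exists>x. f x \<noteq> 0}"

definition mult :: "'v set \<Rightarrow> ('v \<Rightarrow> 'v \<Rightarrow> real) \<Rightarrow> real \<Rightarrow> nat" where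
  "mult W K t = vector_space.dim (\<lambda>(c::real) (f::'v \<Rightarrow> real) x. c * f x) (eigenspace W K t)"

lemma vector_space_fun: "vector_space (\<lambda>(c::real) (f::'v \<Rightarrow> real) x. c * f x)"
  by unfold_locales (auto simp: fun_eq_iff algebra_simps)

text \<open>The image under the identity turns the weighted point masses into a Borel measure.\<close>

definition cumulative_measure :: "'v set \<Rightarrow> ('v \<Rightarrow> 'v \<Rightarrow> real) \<Rightarrow> real measure" where
  "cumulative_measure W K =
     distr (point_measure (spec W K) (\<lambda>t. ennreal (real (mult W K t) / real (card W))))
       borel (\<lambda>t. t)"

definition srw_spectral_measure :: "('v \<Rightarrow> 'v \<Rightarrow> bool) \<Rightarrow> 'v set \<Rightarrow> real measure" where
  "srw_spectral_measure adj W = cumulative_measure W (srw adj W)"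

definition truncated_spectral_measure :: "('v \<Rightarrow> 'v \<Rightarrow> bool) \<Rightarrow> 'v set \<Rightarrow> real measure" where
  "truncated_spectral_measure adj W = cumulative_measure W (srw adj UNIV)"

definition ell2 :: "('v \<Rightarrow> complex) set" where
  "ell2 = {f. (\<lambda>x. (cmod (f x))\<^sup>2) summable_on UNIV}"

definition ell2_inner :: "('v \<Rightarrow> complex) \<Rightarrow> ('v \<Rightarrow> complex) \<Rightarrow> complex" where
  "ell2_inner f g = (\<Sum>\<^sub>\<infinity>x. cnj (f x) * g x)"

definition delta :: "'v \<Rightarrow> 'v \<Rightarrow> complex" where
  "delta v = (\<lambda>x. if x = v then 1 else 0)"

definition srw_operator :: "('v \<Rightarrow> 'v \<Rightarrow> bool) \<Rightarrow> ('v \<Rightarrow> complex) \<Rightarrow> ('v \<Rightarrow> complex)" where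
  "srw_operator adj f = (\<lambda>x. \<Sum>y | adj x y. complex_of_real (srw adj UNIV x y) * f y)"

definition orthogonal_projection :: "(('v \<Rightarrow> complex) \<Rightarrow> ('v \<Rightarrow> complex)) \<Rightarrow> bool" where
  "orthogonal_projection T \<longleftrightarrow>
     (\<forall>f\<in>ell2. T f \<in> ell2) \<and>
     (\<forall>f\<in>ell2. \<forall>g\<in>ell2. \<forall>a b.
        T (\<lambda>x. a * f x + b * g x) = (\<lambda>x. a * T f x + b * T g x)) \<and>
     (\<forall>f\<in>ell2. T (T f) = T f) \<and>
     (\<forall>f\<in>ell2. \<forall>g\<in>ell2. ell2_inner f (T g) = ell2_inner (T f) g)"

text \<open>Projection-valued measures on the Borel sets of the line.\<close>

definition projection_valued_measure ::
  "(real set \<Rightarrow> ('v \<Rightarrow> complex) \<Rightarrow> ('v \<Rightarrow> complex)) \<Rightarrow> bool" where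
  "projection_valued_measure E \<longleftrightarrow>
     (\<forall>A\<in>sets borel. orthogonal_projection (E A)) \<and>
     (\<forall>f\<in>ell2. E {} f = (\<lambda>x. 0)) \<and>
     (\<forall>f\<in>ell2. E UNIV f = f) \<and>
     (\<forall>A\<in>sets borel. \<forall>B\<in>sets borel. \<forall>f\<in>ell2. E (A \<inter> B) f = E A (E B f)) \<and>
     (\<forall>f\<in>ell2. \<forall>g\<in>ell2. \<forall>A :: nat \<Rightarrow> real set.
        range A \<subseteq> sets borel \<longrightarrow> disjoint_family A \<longrightarrow>
        (\<lambda>i. ell2_inner f (E (A i) g)) sums ell2_inner f (E (\<Union>i. A i) g))"

text \<open>
  The measure \<open>A \<mapsto> \<langle>f, E(A) f\<rangle>\<close>; the inner product is real and nonnegative when \<open>E(A)\<close> is an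
  orthogonal projection.
\<close>

definition diagonal_measure ::
  "(real set \<Rightarrow> ('v \<Rightarrow> complex) \<Rightarrow> ('v \<Rightarrow> complex)) \<Rightarrow> ('v \<Rightarrow> complex) \<Rightarrow> real measure" where
  "diagonal_measure E f =
     measure_of UNIV (sets borel) (\<lambda>A. ennreal (Re (ell2_inner f (E A f))))"

text \<open>
  \<open>E\<close> is the resolution of the identity of the bounded self-adjoint operator \<open>T\<close>, that is
  \<open>T = \<integral> t E(dt)\<close> in the weak sense; by polarization it is enough to ask for the diagonal of
  the sesquilinear form. Existence and uniqueness of \<open>E\<close> are the spectral theorem.
\<close>

definition resolution_of_identity ::
  "(('v \<Rightarrow> complex) \<Rightarrow> ('v \<Rightarrow> complex)) \<Rightarrow>
   (real set \<Rightarrow> ('v \<Rightarrow> complex) \<Rightarrow> ('v \<Rightarrow> complex)) \<Rightarrow> bool" where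
  "resolution_of_identity T E \<longleftrightarrow>
     projection_valued_measure E \<and>
     (\<forall>f\<in>ell2. integrable (diagonal_measure E f) (\<lambda>t. t) \<and>
        ell2_inner f (T f) = complex_of_real (\<integral>t. t \<partial>diagonal_measure E f))"

definition plancherel_measure ::
  "(real set \<Rightarrow> ('v \<Rightarrow> complex) \<Rightarrow> ('v \<Rightarrow> complex)) \<Rightarrow> 'v \<Rightarrow> real measure" where
  "plancherel_measure E v = diagonal_measure E (delta v)"

end

theory Submission
  imports Defs
begin

text \<open>
  All the measures in play live on \<open>[-1,1]\<close>, so weak convergence is the same as convergence of
  moments, and every moment is a return probability of the walk: at one vertex for the Plancherel
  measure, averaged over the vertices for a cumulative spectral measure.

  On the finite side, both kernels are self-adjoint for a positive weight: the degree for simple random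
  walk on the subgraph, the constant one for the truncated kernel. Such a kernel has an orthonormal
  eigenbasis (\<open>exists_eigenbasis\<close>), so the \<open>n\<close>-th moment of its cumulative spectral measure is the
  normalised trace of its \<open>n\<close>-th power (\<open>moment_cumulative_measure\<close>).

  On the infinite side, the resolution of the identity is known only through the identity
  \<open>\<langle>f, T f\<rangle> = \<integral> t \<mu>\<^sub>f(dt)\<close>, where \<open>\<mu>\<^sub>f(A) = \<langle>f, E(A) f\<rangle>\<close>. From it one derives that \<open>E\<close> commutes with
  \<open>T\<close>, that a contraction has its spectral measures on \<open>[-1,1]\<close>, and that \<open>\<mu>\<close> of \<open>T h\<close> has density
  \<open>t\<^sup>2\<close> with respect to \<open>\<mu>\<close> of \<open>h\<close>. Iterating the last fact gives \<open>\<integral> t\<^sup>k \<mu>\<^sub>h(dt) = \<langle>h, T\<^sup>k h\<rangle>\<close>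
  (\<open>moment_diagonal\<close>); for the point mass at \<open>v\<close> this is the \<open>k\<close>-step return probability.

  A walk that starts at distance at least \<open>n\<close> from the boundary of \<open>W\<close> cannot tell the finite kernel
  from the infinite one within \<open>n\<close> steps. Hence the trace of the \<open>n\<close>-th power divided by \<open>|W|\<close> differs
  from the return probability, which by transitivity is the same at all vertices, by at most a constant
  times \<open>|\<partial>W| / |W|\<close> (\<open>trace_close_to_return_probability\<close>). Along a sequence whose boundary
  ratios tend to zero all moments therefore converge to those of the Plancherel measure.

  For an expanding sequence the second moment is an obstruction. In a graph of degree \<open>d\<close> the
  two-step return probability is \<open>1/d\<close>, while a boundary vertex loses at least one of its \<open>d\<close>
  neighbours under truncation, so the second moment of the truncated measure is at most
  \<open>1/d - (|\<partial>W| / |W|) / d\<^sup>2\<close> (\<open>truncated_second_moment\<close>) and stays away from \<open>1/d\<close>.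
\<close>

section \<open>Orthonormal eigenbases of reversible kernels\<close>

definition kernel_operator :: "'v set \<Rightarrow> ('v \<Rightarrow> 'v \<Rightarrow> real) \<Rightarrow> ('v \<Rightarrow> real) \<Rightarrow> 'v \<Rightarrow> real" where
  "kernel_operator W K f = (\<lambda>x. if x \<in> W then \<Sum>y\<in>W. K x y * f y else 0)"

definition point_mass :: "'v \<Rightarrow> 'v \<Rightarrow> real" where
  "point_mass x = (\<lambda>y. if y = x then 1 else 0)"

text \<open>
  Reversibility says that the operator is self-adjoint for the inner product with weight \<open>m\<close>. Vectors
  indexed by \<open>W\<close> are functions on the whole vertex type that vanish off \<open>W\<close>.
\<close>

locale reversible_kernel =
  fixes W :: "'v set" and K :: "'v \<Rightarrow> 'v \<Rightarrow> real" and m :: "'v \<Rightarrow> real"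
  assumes finite_W: "finite W"
    and weight_pos: "x \<in> W \<Longrightarrow> 0 < m x"
    and reversible: "x \<in> W \<Longrightarrow> y \<in> W \<Longrightarrow> m x * K x y = m y * K y x"
begin

abbreviation oper :: "('v \<Rightarrow> real) \<Rightarrow> 'v \<Rightarrow> real" where
  "oper \<equiv> kernel_operator W K"

definition inner_W :: "('v \<Rightarrow> real) \<Rightarrow> ('v \<Rightarrow> real) \<Rightarrow> real" where
  "inner_W f g = (\<Sum>x\<in>W. m x * f x * g x)"

definition supported :: "('v \<Rightarrow> real) set" where
  "supported = {f. \<forall>x. x \<notin> W \<longrightarrow> f x = 0}"

text \<open>
  The Rayleigh quotient of a unit vector; on a unit eigenvector it is the eigenvalue.
\<close>

definition rayleigh :: "('v \<Rightarrow> real) \<Rightarrow> real" where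
  "rayleigh f = inner_W (oper f) f"

definition orthonormal :: "('v \<Rightarrow> real) set \<Rightarrow> bool" where
  "orthonormal B \<longleftrightarrow> finite B \<and> B \<subseteq> supported \<and>
     (\<forall>f\<in>B. \<forall>g\<in>B. inner_W f g = (if f = g then 1 else 0))"

text \<open>
  The Gram-Schmidt step: \<open>g\<close> minus its orthogonal projection to the span of \<open>B\<close>.
\<close>

definition residual :: "('v \<Rightarrow> real) set \<Rightarrow> ('v \<Rightarrow> real) \<Rightarrow> 'v \<Rightarrow> real" where
  "residual B g = (\<lambda>x. g x - (\<Sum>f\<in>B. inner_W g f * f x))"

lemma inner_W_commute: "inner_W f g = inner_W g f"
  by (simp add: inner_W_def mult_ac)

lemma inner_W_add: "inner_W (\<lambda>x. f x + g x) h = inner_W f h + inner_W g h"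
  by (simp add: inner_W_def algebra_simps sum.distrib)

lemma inner_W_diff: "inner_W (\<lambda>x. f x - g x) h = inner_W f h - inner_W g h"
  by (simp add: inner_W_def algebra_simps sum_subtractf)

lemma inner_W_scale: "inner_W (\<lambda>x. c * f x) h = c * inner_W f h"
  by (simp add: inner_W_def algebra_simps sum_distrib_left)

lemma inner_W_scale_right: "inner_W h (\<lambda>x. c * f x) = c * inner_W h f"
  by (metis inner_W_commute inner_W_scale)

lemma inner_W_sum:
  "inner_W (\<lambda>x. \<Sum>i\<in>I. c i * f i x) h = (\<Sum>i\<in>I. c i * inner_W (f i) h)"
proof -
  have "inner_W (\<lambda>x. \<Sum>i\<in>I. c i * f i x) h = (\<Sum>x\<in>W. \<Sum>i\<in>I. c i * (m x * f i x * h x))"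
    by (simp add: inner_W_def sum_distrib_left sum_distrib_right mult_ac)
  also have "\<dots> = (\<Sum>i\<in>I. \<Sum>x\<in>W. c i * (m x * f i x * h x))" by (rule sum.swap)
  finally show ?thesis by (simp add: inner_W_def sum_distrib_left)
qed

lemma inner_W_zero [simp]: "inner_W (\<lambda>x. 0) h = 0" "inner_W h (\<lambda>x. 0) = 0"
  by (simp_all add: inner_W_def)

lemma inner_W_self_nonneg: "0 \<le> inner_W f f"
  unfolding inner_W_def using weight_pos
  by (intro sum_nonneg) (simp add: less_imp_le mult.assoc)

lemma inner_W_self_eq_0:
  assumes "f \<in> supported" "inner_W f f = 0"
  shows "f = (\<lambda>x. 0)"
proof
  fix x
  have "\<forall>x\<in>W. m x * f x * f x = 0"
    using assms(2) finite_W weight_pos unfolding inner_W_def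
    by (subst (asm) sum_nonneg_eq_0_iff) (auto simp: less_imp_le mult.assoc)
  then show "f x = 0" using assms(1) weight_pos[of x] by (cases "x \<in> W") (auto simp: supported_def)
qed

lemma oper_self_adjoint: "inner_W (oper f) g = inner_W f (oper g)"
proof -
  have "inner_W (oper f) g = (\<Sum>x\<in>W. \<Sum>y\<in>W. (m x * K x y) * f y * g x)"
    by (simp add: inner_W_def kernel_operator_def sum_distrib_left sum_distrib_right mult_ac)
  also have "\<dots> = (\<Sum>x\<in>W. \<Sum>y\<in>W. (m y * K y x) * f y * g x)"
    by (intro sum.cong refl) (simp add: reversible)
  also have "\<dots> = (\<Sum>y\<in>W. \<Sum>x\<in>W. (m y * K y x) * f y * g x)" by (rule sum.swap)
  also have "\<dots> = inner_W f (oper g)"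
    by (simp add: inner_W_def kernel_operator_def sum_distrib_left sum_distrib_right mult_ac)
  finally show ?thesis .
qed

lemma oper_supported: "oper f \<in> supported"
  by (simp add: kernel_operator_def supported_def)

lemma oper_add: "oper (\<lambda>x. f x + g x) = (\<lambda>x. oper f x + oper g x)"
  by (auto simp: kernel_operator_def fun_eq_iff algebra_simps sum.distrib)

lemma oper_scale: "oper (\<lambda>x. c * f x) = (\<lambda>x. c * oper f x)"
  by (auto simp: kernel_operator_def fun_eq_iff algebra_simps sum_distrib_left)

lemma oper_sum: "oper (\<lambda>x. \<Sum>i\<in>I. c i * f i x) = (\<lambda>x. \<Sum>i\<in>I. c i * oper (f i) x)"
proof
  fix x
  have "(\<Sum>y\<in>W. K x y * (\<Sum>i\<in>I. c i * f i y)) = (\<Sum>y\<in>W. \<Sum>i\<in>I. c i * (K x y * f i y))"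
    by (simp add: sum_distrib_left mult_ac)
  also have "\<dots> = (\<Sum>i\<in>I. \<Sum>y\<in>W. c i * (K x y * f i y))" by (rule sum.swap)
  finally show "oper (\<lambda>x. \<Sum>i\<in>I. c i * f i x) x = (\<Sum>i\<in>I. c i * oper (f i) x)"
    by (simp add: kernel_operator_def sum_distrib_left)
qed

lemma point_mass_supported: "x \<in> W \<Longrightarrow> point_mass x \<in> supported"
  by (auto simp: point_mass_def supported_def)

lemma inner_W_point_mass: "x \<in> W \<Longrightarrow> inner_W (point_mass x) f = m x * f x"
  using finite_W by (simp add: inner_W_def point_mass_def if_distrib if_distribR cong: if_cong)

lemma residual_supported:
  assumes "orthonormal B" "g \<in> supported"
  shows "residual B g \<in> supported"
  using assms by (auto simp: residual_def supported_def orthonormal_def subset_iff intro!: sum.neutral)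

lemma residual_orthogonal:
  assumes B: "orthonormal B" and h: "h \<in> B"
  shows "inner_W (residual B g) h = 0"
proof -
  have "(\<Sum>f\<in>B. inner_W g f * inner_W f h) = (\<Sum>f\<in>B. if f = h then inner_W g f else 0)"
    using B h by (intro sum.cong) (auto simp: orthonormal_def)
  then show ?thesis
    using B h by (simp add: residual_def inner_W_diff inner_W_sum orthonormal_def)
qed

lemma inner_W_residual_self:
  assumes B: "orthonormal B"
  shows "inner_W (residual B g) (residual B g) = inner_W g g - (\<Sum>f\<in>B. (inner_W g f)\<^sup>2)"
proof -
  let ?r = "residual B g"
  have "inner_W ?r ?r = inner_W g ?r - (\<Sum>f\<in>B. inner_W g f * inner_W f ?r)"
    by (subst (1) residual_def) (simp add: inner_W_diff inner_W_sum)
  also have "(\<Sum>f\<in>B. inner_W g f * inner_W f ?r) = 0"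
    using residual_orthogonal[OF B] by (intro sum.neutral) (simp add: inner_W_commute[of _ ?r])
  also have "inner_W g ?r = inner_W ?r g" by (rule inner_W_commute)
  also have "\<dots> = inner_W g g - (\<Sum>f\<in>B. inner_W g f * inner_W f g)"
    by (simp add: residual_def inner_W_diff inner_W_sum)
  also have "(\<Sum>f\<in>B. inner_W g f * inner_W f g) = (\<Sum>f\<in>B. (inner_W g f)\<^sup>2)"
    by (intro sum.cong) (simp_all add: power2_eq_square inner_W_commute)
  finally show ?thesis by simp
qed

text \<open>
  The factor \<open>1 - (\<Sum>f\<in>B. m x * (f x)\<^sup>2)\<close> is the squared distance of the normalised point mass at
  \<open>x\<close> to the span of \<open>B\<close>. Summed over \<open>x\<close> these defects count how many vectors \<open>B\<close> lacks to be a
  basis, which replaces an appeal to dimension theory: with \<open>|W|\<close> vectors every defect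
  vanishes, with fewer some defect is positive.
\<close>

lemma residual_point_mass_norm:
  assumes "orthonormal B" "x \<in> W"
  shows "inner_W (residual B (point_mass x)) (residual B (point_mass x)) =
    m x * (1 - (\<Sum>f\<in>B. m x * (f x)\<^sup>2))"
proof -
  have "inner_W (point_mass x) (point_mass x) = m x"
    using assms(2) by (simp add: inner_W_point_mass) (simp add: point_mass_def)
  then show ?thesis using assms
    by (simp add: inner_W_residual_self inner_W_point_mass power2_eq_square algebra_simps sum_distrib_left)
qed

lemma sum_defects:
  assumes "orthonormal B"
  shows "(\<Sum>x\<in>W. 1 - (\<Sum>f\<in>B. m x * (f x)\<^sup>2)) = real (card W) - real (card B)"
proof -
  have "(\<Sum>x\<in>W. \<Sum>f\<in>B. m x * (f x)\<^sup>2) = (\<Sum>f\<in>B. \<Sum>x\<in>W. m x * (f x)\<^sup>2)" by (rule sum.swap)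
  also have "\<dots> = (\<Sum>f\<in>B. inner_W f f)"
    by (simp add: inner_W_def power2_eq_square mult.assoc)
  also have "\<dots> = real (card B)" using assms by (simp add: orthonormal_def)
  finally show ?thesis by (simp add: sum_subtractf)
qed

lemma defect_nonneg:
  assumes "orthonormal B" "x \<in> W"
  shows "0 \<le> 1 - (\<Sum>f\<in>B. m x * (f x)\<^sup>2)"
  using inner_W_self_nonneg[of "residual B (point_mass x)"] weight_pos[OF assms(2)]
  unfolding residual_point_mass_norm[OF assms] by (simp add: zero_le_mult_iff)

lemma complete_point_mass:
  assumes B: "orthonormal B" and card: "card B = card W" and x: "x \<in> W"
  shows "point_mass x = (\<lambda>y. \<Sum>f\<in>B. m x * f x * f y)"
proof -
  have "(\<Sum>x\<in>W. 1 - (\<Sum>f\<in>B. m x * (f x)\<^sup>2)) = 0" by (simp only: sum_defects[OF B] card)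
  then have "1 - (\<Sum>f\<in>B. m x * (f x)\<^sup>2) = 0"
    using defect_nonneg[OF B] x finite_W by (subst (asm) sum_nonneg_eq_0_iff) auto
  then have "inner_W (residual B (point_mass x)) (residual B (point_mass x)) = 0"
    by (simp add: residual_point_mass_norm[OF B x])
  then have "residual B (point_mass x) = (\<lambda>y. 0)"
    by (rule inner_W_self_eq_0[OF residual_supported[OF B point_mass_supported[OF x]]])
  then show ?thesis using x by (simp add: residual_def fun_eq_iff inner_W_point_mass)
qed

text \<open>
  Some point mass has a positive defect, and its residual can be normalised.
\<close>

lemma exists_orthogonal_unit:
  assumes B: "orthonormal B" and card: "card B < card W"
  shows "\<exists>h\<in>supported. inner_W h h = 1 \<and> (\<forall>f\<in>B. inner_W h f = 0)"
proof -
  have "\<exists>x\<in>W. 0 < 1 - (\<Sum>f\<in>B. m x * (f x)\<^sup>2)"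
  proof (rule ccontr)
    assume "\<not> ?thesis"
    then have "(\<Sum>x\<in>W. 1 - (\<Sum>f\<in>B. m x * (f x)\<^sup>2)) \<le> 0" by (intro sum_nonpos) force
    then show False using card unfolding sum_defects[OF B] by simp
  qed
  then obtain x where x: "x \<in> W" "0 < 1 - (\<Sum>f\<in>B. m x * (f x)\<^sup>2)" by blast
  define r where "r = residual B (point_mass x)"
  have pos: "0 < inner_W r r"
    unfolding r_def residual_point_mass_norm[OF B x(1)] using x weight_pos by simp
  define h where "h = (\<lambda>y. (1 / sqrt (inner_W r r)) * r y)"
  have "h \<in> supported"
    using residual_supported[OF B point_mass_supported[OF x(1)]] by (simp add: h_def r_def supported_def)
  moreover have "inner_W h h = 1"
    unfolding h_def inner_W_scale inner_W_scale_right using pos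
    by (simp add: field_simps)
  moreover have "\<forall>f\<in>B. inner_W h f = 0"
    unfolding h_def inner_W_scale using residual_orthogonal[OF B] by (simp add: r_def)
  ultimately show ?thesis by blast
qed

lemma continuous_coordinate: "continuous_on S (\<lambda>f :: 'v \<Rightarrow> real. f x)"
  by (rule continuous_on_subset[OF continuous_on_product_coordinates subset_UNIV])

lemma continuous_inner_W:
  assumes "\<And>x. x \<in> W \<Longrightarrow> continuous_on S (\<lambda>f. F f x)" "\<And>x. x \<in> W \<Longrightarrow> continuous_on S (\<lambda>f. G f x)"
  shows "continuous_on S (\<lambda>f :: 'v \<Rightarrow> real. inner_W (F f) (G f))"
  unfolding inner_W_def by (intro continuous_intros assms)

text \<open>
  In the product topology on functions these vectors form a closed subset of a box, which is compact by
  Tychonoff's theorem: a unit vector satisfies \<open>m x * (f x)\<^sup>2 \<le> 1\<close> at every \<open>x\<close>.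
\<close>

lemma compact_unit_vectors:
  "compact {h\<in>supported. inner_W h h = 1 \<and> (\<forall>f\<in>B. inner_W h f = 0)}" (is "compact ?S")
proof -
  define C where "C = (\<lambda>x. if x \<in> W then {- (1 / sqrt (m x)) .. 1 / sqrt (m x)} else {0 :: real})"
  have "compactin (product_topology (\<lambda>_. euclidean) UNIV) (PiE UNIV C)"
    by (subst compactin_PiE) (auto simp: C_def)
  then have C: "compact (PiE UNIV C)" by (simp add: euclidean_product_topology)
  have sub: "?S \<subseteq> PiE UNIV C"
  proof
    fix h assume h: "h \<in> ?S"
    have "\<bar>h x\<bar> \<le> 1 / sqrt (m x)" if x: "x \<in> W" for x
    proof -
      have "m x * h x * h x \<le> (\<Sum>x\<in>W. m x * h x * h x)"
        using finite_W x weight_pos by (intro member_le_sum) (auto simp: mult.assoc less_imp_le)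
      also have "\<dots> = 1" using h by (simp add: inner_W_def)
      finally have "(h x)\<^sup>2 \<le> 1 / m x"
        using weight_pos[OF x] by (simp add: field_simps power2_eq_square)
      then have "sqrt ((h x)\<^sup>2) \<le> sqrt (1 / m x)" by (rule real_sqrt_le_mono)
      then show ?thesis by (simp add: real_sqrt_divide)
    qed
    then show "h \<in> PiE UNIV C" using h by (auto simp: C_def supported_def abs_le_iff minus_le_iff)
  qed
  have "?S = PiE UNIV C \<inter> ((\<Inter>x\<in>-W. {h. h x = 0}) \<inter> {h. inner_W h h = 1} \<inter> (\<Inter>f\<in>B. {h. inner_W h f = 0}))"
    using sub by (auto simp: supported_def)
  moreover have "closed ((\<Inter>x\<in>-W. {h. h x = 0}) \<inter> {h. inner_W h h = 1} \<inter> (\<Inter>f\<in>B. {h. inner_W h f = 0}))"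
    by (intro closed_Int closed_INT ballI closed_Collect_eq continuous_inner_W
        continuous_coordinate continuous_on_const)
  ultimately show ?thesis using C by (simp add: compact_Int_closed)
qed

text \<open>
  The new eigenvector \<open>h\<close> maximises the Rayleigh quotient over the unit vectors orthogonal to \<open>B\<close>. The
  form \<open>rayleigh h * \<langle>u,u\<rangle> - \<langle>oper u, u\<rangle>\<close> is then nonnegative on the orthogonal complement of \<open>B\<close> and
  vanishes at \<open>h\<close>, so its first variation there is zero. Since the complement is invariant, the
  variation may be taken in the direction \<open>g = oper h - rayleigh h * h\<close>, which forces \<open>g = 0\<close>.
\<close>

lemma extend_eigenbasis:
  assumes B: "orthonormal B" and eig: "\<And>f. f \<in> B \<Longrightarrow> oper f = (\<lambda>x. rayleigh f * f x)"
    and card: "card B < card W"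
  shows "\<exists>h. h \<notin> B \<and> orthonormal (insert h B) \<and> oper h = (\<lambda>x. rayleigh h * h x)"
proof -
  let ?S = "{h\<in>supported. inner_W h h = 1 \<and> (\<forall>f\<in>B. inner_W h f = 0)}"
  have "continuous_on ?S rayleigh"
    unfolding rayleigh_def
    by (intro continuous_inner_W continuous_coordinate) (simp add: kernel_operator_def, intro continuous_intros continuous_coordinate)
  then obtain h where h: "h \<in> ?S" and max: "\<And>g. g \<in> ?S \<Longrightarrow> rayleigh g \<le> rayleigh h"
    using continuous_attains_sup[OF compact_unit_vectors, of B rayleigh] exists_orthogonal_unit[OF B card]
    by blast
  define V where "V = {g\<in>supported. \<forall>f\<in>B. inner_W g f = 0}"
  have hV: "h \<in> V" using h by (simp add: V_def)
  have form: "inner_W (oper g) g \<le> rayleigh h * inner_W g g" if g: "g \<in> V" for g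
  proof (cases "inner_W g g = 0")
    case True
    then have "g = (\<lambda>x. 0)" using g inner_W_self_eq_0 by (simp add: V_def)
    then show ?thesis by simp
  next
    case False
    then have pos: "0 < inner_W g g" using inner_W_self_nonneg[of g] by linarith
    define c where "c = 1 / sqrt (inner_W g g)"
    have c2: "c * (c * inner_W g g) = 1" using pos by (simp add: c_def field_simps)
    have "(\<lambda>x. c * g x) \<in> ?S" using g c2
      by (auto simp: V_def supported_def inner_W_scale inner_W_scale_right)
    from max[OF this] have "c * (c * inner_W (oper g) g) \<le> rayleigh h"
      by (simp add: rayleigh_def oper_scale inner_W_scale inner_W_scale_right)
    then have "(c * (c * inner_W (oper g) g)) * inner_W g g \<le> rayleigh h * inner_W g g"
      using pos by (intro mult_right_mono) auto
    moreover have "(c * (c * inner_W (oper g) g)) * inner_W g g = inner_W (oper g) g * (c * (c * inner_W g g))"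
      by simp
    ultimately show ?thesis by (simp add: c2)
  qed
  define g where "g = (\<lambda>x. oper h x + (- rayleigh h) * h x)"
  have oper_orth: "inner_W (oper h) f = 0" if f: "f \<in> B" for f
  proof -
    have "inner_W (oper h) f = inner_W h (\<lambda>x. rayleigh f * f x)"
      by (simp add: oper_self_adjoint eig[OF f, symmetric])
    then show ?thesis using h f by (simp add: inner_W_scale_right)
  qed
  have "inner_W g f = 0" if "f \<in> B" for f
    using h that oper_orth[OF that] unfolding g_def by (simp only: inner_W_add inner_W_scale) simp
  then have gV: "g \<in> V"
    using h oper_supported[of h] by (auto simp: V_def g_def supported_def)
  have gh: "inner_W g h = 0"
    using h unfolding g_def by (simp only: inner_W_add inner_W_scale) (simp add: rayleigh_def)
  have oper_h: "oper h = (\<lambda>x. g x + rayleigh h * h x)" by (simp add: g_def)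
  define e where "e = rayleigh h * inner_W g g - inner_W (oper g) g"
  have first_variation: "2 * s * inner_W g g \<le> s\<^sup>2 * e" for s
  proof -
    let ?u = "\<lambda>x. h x + s * g x"
    have "?u \<in> V" using hV gV by (auto simp: V_def supported_def inner_W_add inner_W_scale)
    then have "inner_W (oper ?u) ?u \<le> rayleigh h * inner_W ?u ?u" by (rule form)
    moreover have "inner_W ?u ?u = 1 + s\<^sup>2 * inner_W g g"
    proof -
      have "inner_W ?u ?u = inner_W h ?u + s * inner_W g ?u" by (simp add: inner_W_add inner_W_scale)
      also have "inner_W h ?u = inner_W h h + s * inner_W g h"
        by (subst inner_W_commute) (simp add: inner_W_add inner_W_scale)
      also have "inner_W g ?u = inner_W h g + s * inner_W g g"
        by (subst inner_W_commute) (simp add: inner_W_add inner_W_scale)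
      finally show ?thesis using h gh by (simp add: inner_W_commute[of h g] power2_eq_square)
    qed
    moreover have "inner_W (oper ?u) ?u = rayleigh h + 2 * s * inner_W g g + s\<^sup>2 * inner_W (oper g) g"
    proof -
      have hg: "inner_W (oper h) g = inner_W g g"
        using gh by (simp add: oper_h inner_W_add inner_W_scale inner_W_commute[of h g])
      have "inner_W (oper ?u) ?u = inner_W (oper h) ?u + s * inner_W (oper g) ?u"
        by (simp add: oper_add oper_scale inner_W_add inner_W_scale)
      also have "inner_W (oper h) ?u = rayleigh h + s * inner_W (oper h) g"
        by (subst (1) inner_W_commute)
           (simp add: inner_W_add inner_W_scale rayleigh_def inner_W_commute[of _ "oper h"])
      also have "inner_W (oper g) ?u = inner_W (oper h) g + s * inner_W (oper g) g"
        by (subst (1) inner_W_commute)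
           (simp add: inner_W_add inner_W_scale oper_self_adjoint[symmetric] inner_W_commute[of g "oper g"])
      finally show ?thesis by (simp add: hg power2_eq_square algebra_simps)
    qed
    ultimately show ?thesis by (simp add: e_def algebra_simps)
  qed
  have "inner_W g g \<le> 0"
  proof (rule ccontr)
    assume "\<not> ?thesis"
    then have pos: "0 < inner_W g g" by simp
    \<comment> \<open>A step small enough for the linear term of the variation to dominate the quadratic one.\<close>
    define s where "s = inner_W g g / (\<bar>e\<bar> + 1)"
    have s: "0 < s" using pos by (simp add: s_def)
    have "2 * s * inner_W g g \<le> s * (s * \<bar>e\<bar>)"
      using order_trans[OF first_variation[of s] mult_left_mono[OF abs_ge_self[of e]]]
      by (simp add: power2_eq_square mult.assoc)
    then have "s * (2 * inner_W g g) \<le> s * (s * \<bar>e\<bar>)" by (simp add: mult_ac)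
    then have "2 * inner_W g g \<le> s * \<bar>e\<bar>" using s by (simp only: mult_le_cancel_left_pos)
    also have "\<dots> \<le> inner_W g g" using pos by (simp add: s_def field_simps)
    finally show False using pos by simp
  qed
  then have "g = (\<lambda>x. 0)"
    using inner_W_self_nonneg[of g] gV by (intro inner_W_self_eq_0) (auto simp: V_def)
  then have 1: "oper h = (\<lambda>x. rayleigh h * h x)" by (simp add: oper_h)
  have 2: "h \<notin> B" using h B by auto
  have hB: "inner_W h f = 0" "inner_W f h = 0" if "f \<in> B" for f
    using h that by (simp_all add: inner_W_commute[of f h])
  have "orthonormal (insert h B)"
    using h B 2 hB unfolding orthonormal_def by auto
  then show ?thesis using 1 2 by blast
qed

theorem exists_eigenbasis:
  "\<exists>B. orthonormal B \<and> card B = card W \<and> (\<forall>f\<in>B. oper f = (\<lambda>x. rayleigh f * f x))"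
proof -
  have "\<exists>B. orthonormal B \<and> card B = n \<and> (\<forall>f\<in>B. oper f = (\<lambda>x. rayleigh f * f x))"
    if "n \<le> card W" for n
    using that
  proof (induction n)
    case 0
    then show ?case by (intro exI[of _ "{}"]) (simp add: orthonormal_def)
  next
    case (Suc n)
    then obtain B where B: "orthonormal B" "card B = n" "\<forall>f\<in>B. oper f = (\<lambda>x. rayleigh f * f x)"
      by auto
    with extend_eigenbasis[of B] Suc.prems obtain h where
      "h \<notin> B" "orthonormal (insert h B)" "oper h = (\<lambda>x. rayleigh h * h x)" by auto
    with B show ?case by (intro exI[of _ "insert h B"]) (auto simp: orthonormal_def)
  qed
  then show ?thesis by simp
qed

definition eigenbasis :: "('v \<Rightarrow> real) set" where
  "eigenbasis = (SOME B. orthonormal B \<and> card B = card W \<and> (\<forall>f\<in>B. oper f = (\<lambda>x. rayleigh f * f x)))"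

lemma eigenbasis:
  shows eigenbasis_orthonormal: "orthonormal eigenbasis"
    and card_eigenbasis: "card eigenbasis = card W"
    and oper_eigenbasis: "f \<in> eigenbasis \<Longrightarrow> oper f = (\<lambda>x. rayleigh f * f x)"
  using someI_ex[OF exists_eigenbasis] unfolding eigenbasis_def by auto

lemma finite_eigenbasis: "finite eigenbasis"
  using eigenbasis_orthonormal by (simp add: orthonormal_def)

text \<open>
  Expand the point mass at \<open>x\<close> in the eigenbasis and sum over \<open>x\<close>; each eigenvector contributes its
  squared norm.
\<close>

lemma trace_power:
  "(\<Sum>x\<in>W. (oper ^^ n) (point_mass x) x) = (\<Sum>f\<in>eigenbasis. rayleigh f ^ n)"
proof -
  have pow: "(oper ^^ n) (point_mass x) = (\<lambda>y. \<Sum>f\<in>eigenbasis. m x * f x * rayleigh f ^ n * f y)"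
    if x: "x \<in> W" for x
  proof (induction n)
    case 0
    then show ?case using complete_point_mass[OF eigenbasis_orthonormal card_eigenbasis x] by simp
  next
    case (Suc n)
    show ?case
      by (simp add: Suc oper_sum) (intro ext sum.cong refl, simp add: oper_eigenbasis)
  qed
  have "(\<Sum>x\<in>W. (oper ^^ n) (point_mass x) x) = (\<Sum>x\<in>W. \<Sum>f\<in>eigenbasis. rayleigh f ^ n * (m x * f x * f x))"
    by (intro sum.cong refl) (simp add: pow mult_ac)
  also have "\<dots> = (\<Sum>f\<in>eigenbasis. \<Sum>x\<in>W. rayleigh f ^ n * (m x * f x * f x))" by (rule sum.swap)
  also have "\<dots> = (\<Sum>f\<in>eigenbasis. rayleigh f ^ n * inner_W f f)"
    by (simp add: inner_W_def sum_distrib_left)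
  also have "\<dots> = (\<Sum>f\<in>eigenbasis. rayleigh f ^ n)"
    using eigenbasis_orthonormal by (intro sum.cong) (auto simp: orthonormal_def)
  finally show ?thesis .
qed

lemma expansion:
  assumes "g \<in> supported"
  shows "g = (\<lambda>y. \<Sum>f\<in>eigenbasis. inner_W g f * f y)"
proof
  fix y
  have "(\<Sum>f\<in>eigenbasis. inner_W g f * f y) = (\<Sum>f\<in>eigenbasis. \<Sum>x\<in>W. m x * f x * f y * g x)"
    by (simp add: inner_W_def sum_distrib_left sum_distrib_right mult_ac)
  also have "\<dots> = (\<Sum>x\<in>W. (\<Sum>f\<in>eigenbasis. m x * f x * f y) * g x)"
    by (subst sum.swap) (simp add: sum_distrib_right)
  also have "\<dots> = (\<Sum>x\<in>W. point_mass x y * g x)"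
    using complete_point_mass[OF eigenbasis_orthonormal card_eigenbasis] by (intro sum.cong refl) simp
  also have "\<dots> = g y"
    using assms finite_W by (simp add: point_mass_def supported_def if_distrib[of "\<lambda>c. c * _"] cong: if_cong)
  finally show "g y = (\<Sum>f\<in>eigenbasis. inner_W g f * f y)" by simp
qed

lemma eigenspace_iff: "g \<in> eigenspace W K t \<longleftrightarrow> g \<in> supported \<and> oper g = (\<lambda>x. t * g x)"
  by (auto simp: eigenspace_def supported_def kernel_operator_def fun_eq_iff)

text \<open>
  Eigenvectors for different eigenvalues are orthogonal, so an eigenspace is spanned by the basis vectors
  that it contains.
\<close>

lemma eigenspace_coefficient:
  assumes g: "g \<in> eigenspace W K t" and f: "f \<in> eigenbasis" and ne: "inner_W g f \<noteq> 0"
  shows "rayleigh f = t"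
proof -
  have "t * inner_W g f = inner_W (oper g) f" using g by (simp add: eigenspace_iff inner_W_scale)
  also have "\<dots> = rayleigh f * inner_W g f"
    by (simp add: oper_self_adjoint oper_eigenbasis[OF f] inner_W_scale_right)
  finally show ?thesis using ne by simp
qed

lemma eigenspace_expansion:
  assumes g: "g \<in> eigenspace W K t"
  shows "g = (\<lambda>y. \<Sum>f | f \<in> eigenbasis \<and> rayleigh f = t. inner_W g f * f y)"
proof -
  have "(\<Sum>f\<in>eigenbasis. inner_W g f * f y) =
      (\<Sum>f | f \<in> eigenbasis \<and> rayleigh f = t. inner_W g f * f y)" for y
    using eigenspace_coefficient[OF g] finite_eigenbasis by (intro sum.mono_neutral_right) auto
  then show ?thesis using expansion[of g] g by (simp add: eigenspace_iff)
qed

lemma eigenbasis_in_eigenspace: "f \<in> eigenbasis \<Longrightarrow> f \<in> eigenspace W K (rayleigh f)"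
  using eigenbasis_orthonormal oper_eigenbasis by (auto simp: eigenspace_iff orthonormal_def)

lemma spec_eq: "spec W K = rayleigh ` eigenbasis"
proof
  show "spec W K \<subseteq> rayleigh ` eigenbasis"
  proof
    fix t assume "t \<in> spec W K"
    then obtain g x where g: "g \<in> eigenspace W K t" "g x \<noteq> 0" by (auto simp: spec_def)
    then have "{f \<in> eigenbasis. rayleigh f = t} \<noteq> {}"
      using eigenspace_expansion[OF g(1)] by (metis (no_types, lifting) sum.empty)
    then show "t \<in> rayleigh ` eigenbasis" by auto
  qed
  show "rayleigh ` eigenbasis \<subseteq> spec W K"
  proof clarify
    fix f assume f: "f \<in> eigenbasis"
    have "inner_W f f = 1" using f eigenbasis_orthonormal by (simp add: orthonormal_def)
    then have "f \<noteq> (\<lambda>x. 0)" by auto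
    then show "rayleigh f \<in> spec W K"
      using eigenbasis_in_eigenspace[OF f] by (auto simp: spec_def fun_eq_iff)
  qed
qed

lemma mult_eq: "mult W K t = card {f \<in> eigenbasis. rayleigh f = t}"
proof -
  interpret vs: vector_space "\<lambda>(c::real) (f::'v \<Rightarrow> real) x. c * f x" by (rule vector_space_fun)
  let ?B = "{f \<in> eigenbasis. rayleigh f = t}"
  have sum_app: "(\<Sum>f\<in>A. F f) x = (\<Sum>f\<in>A. F f x)" for F :: "('v \<Rightarrow> real) \<Rightarrow> 'v \<Rightarrow> real" and A x
    by (induction A rule: infinite_finite_induct) auto
  have "vs.dim (eigenspace W K t) = card ?B"
  proof (rule vs.dim_unique)
    show "?B \<subseteq> eigenspace W K t" using eigenbasis_in_eigenspace by auto
    show "eigenspace W K t \<subseteq> vs.span ?B"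
    proof
      fix g assume g: "g \<in> eigenspace W K t"
      have "g = (\<Sum>f\<in>?B. (\<lambda>x. inner_W g f * f x))"
        using eigenspace_expansion[OF g] by (simp add: fun_eq_iff sum_app)
      also have "\<dots> \<in> vs.span ?B"
        by (intro vs.span_sum) (rule vs.span_scale[OF vs.span_base])
      finally show "g \<in> vs.span ?B" .
    qed
    show "vs.independent ?B"
    proof (rule vs.independent_if_scalars_zero)
      show "finite ?B" using finite_eigenbasis by simp
      fix u h assume z: "(\<Sum>f\<in>?B. (\<lambda>x. u f * f x)) = 0" and h: "h \<in> ?B"
      have "(\<lambda>x. \<Sum>f\<in>?B. u f * f x) = (\<lambda>x. 0)" using z by (simp add: fun_eq_iff sum_app)
      then have "0 = inner_W (\<lambda>x. \<Sum>f\<in>?B. u f * f x) h" by simp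
      also have "\<dots> = (\<Sum>f\<in>?B. u f * inner_W f h)" by (rule inner_W_sum)
      also have "\<dots> = (\<Sum>f\<in>?B. if f = h then u f else 0)"
        using eigenbasis_orthonormal h by (intro sum.cong) (auto simp: orthonormal_def)
      also have "\<dots> = u h" using h finite_eigenbasis by simp
      finally show "u h = 0" by simp
    qed
  qed simp
  then show ?thesis by (simp add: mult_def)
qed

lemma sum_spec:
  fixes g :: "real \<Rightarrow> real"
  shows "(\<Sum>t\<in>spec W K. real (mult W K t) * g t) = (\<Sum>f\<in>eigenbasis. g (rayleigh f))"
proof -
  have "(\<Sum>f\<in>eigenbasis. g (rayleigh f)) =
      (\<Sum>t\<in>rayleigh ` eigenbasis. \<Sum>f | f \<in> eigenbasis \<and> rayleigh f = t. g (rayleigh f))"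
    by (rule sum.image_gen[OF finite_eigenbasis])
  also have "\<dots> = (\<Sum>t\<in>spec W K. real (mult W K t) * g t)"
    unfolding spec_eq by (intro sum.cong refl) (simp add: mult_eq)
  finally show ?thesis by simp
qed

end

section \<open>Moments of cumulative spectral measures\<close>

locale substochastic_kernel = reversible_kernel +
  assumes W_nonempty: "W \<noteq> {}"
    and row_sum: "x \<in> W \<Longrightarrow> (\<Sum>y\<in>W. \<bar>K x y\<bar>) \<le> 1"
begin

text \<open>
  Maximum principle: evaluate the eigenvector equation at a vertex where \<open>|f|\<close> is largest.
\<close>

lemma eigenvalue_bound:
  assumes "t \<in> spec W K"
  shows "\<bar>t\<bar> \<le> 1"
proof -
  obtain f z where f: "f \<in> eigenspace W K t" and z: "f z \<noteq> 0" using assms by (auto simp: spec_def)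
  have "z \<in> W" using f z by (auto simp: eigenspace_def)
  have "Max ((\<lambda>x. \<bar>f x\<bar>) ` W) \<in> (\<lambda>x. \<bar>f x\<bar>) ` W"
    using finite_W W_nonempty by (intro Max_in) auto
  then obtain x where xW: "x \<in> W" and x: "Max ((\<lambda>x. \<bar>f x\<bar>) ` W) = \<bar>f x\<bar>" by auto
  have max: "\<bar>f y\<bar> \<le> \<bar>f x\<bar>" if "y \<in> W" for y
    using that finite_W by (auto simp flip: x)
  have pos: "0 < \<bar>f x\<bar>" using max[OF \<open>z \<in> W\<close>] z by linarith
  have "\<bar>t\<bar> * \<bar>f x\<bar> = \<bar>\<Sum>y\<in>W. K x y * f y\<bar>"
    using f xW by (simp add: eigenspace_def abs_mult)
  also have "\<dots> \<le> (\<Sum>y\<in>W. \<bar>K x y * f y\<bar>)" by (rule sum_abs)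
  also have "\<dots> \<le> (\<Sum>y\<in>W. \<bar>K x y\<bar> * \<bar>f x\<bar>)"
    using max by (intro sum_mono) (simp add: abs_mult mult_left_mono)
  also have "\<dots> = (\<Sum>y\<in>W. \<bar>K x y\<bar>) * \<bar>f x\<bar>" by (simp add: sum_distrib_right)
  also have "\<dots> \<le> 1 * \<bar>f x\<bar>" by (rule mult_right_mono[OF row_sum[OF xW]]) simp
  finally show ?thesis using pos by (simp add: mult_le_cancel_right)
qed

lemma finite_spec: "finite (spec W K)"
  using finite_eigenbasis by (simp add: spec_eq)

lemma card_W_pos: "0 < real (card W)"
  using finite_W W_nonempty by (simp add: card_gt_0_iff)

lemma integral_cumulative_measure:
  fixes g :: "real \<Rightarrow> real"
  assumes "g \<in> borel_measurable borel"
  shows "(\<integral>t. g t \<partial>cumulative_measure W K) = (\<Sum>f\<in>eigenbasis. g (rayleigh f)) / real (card W)"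
proof -
  have "(\<integral>t. g t \<partial>cumulative_measure W K) =
      (\<integral>t. g t \<partial>point_measure (spec W K) (\<lambda>t. ennreal (real (mult W K t) / real (card W))))"
    unfolding cumulative_measure_def
    by (rule integral_distr[OF _ assms]) (simp add: measurable_def space_point_measure sets_point_measure)
  also have "\<dots> = (\<Sum>t\<in>spec W K. real (mult W K t) / real (card W) * g t)"
    by (subst lebesgue_integral_point_measure_finite[OF finite_spec]) simp_all
  also have "\<dots> = (\<Sum>f\<in>eigenbasis. g (rayleigh f)) / real (card W)"
    by (simp add: sum_spec[symmetric] sum_divide_distrib)
  finally show ?thesis .
qed

lemma real_distribution_cumulative_measure: "real_distribution (cumulative_measure W K)"
proof -
  let ?P = "point_measure (spec W K) (\<lambda>t. ennreal (real (mult W K t) / real (card W)))"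
  have "(\<Sum>t\<in>spec W K. real (mult W K t) / real (card W)) = 1"
    using sum_spec[of "\<lambda>_. 1"] card_W_pos by (simp add: sum_divide_distrib[symmetric] card_eigenbasis)
  then have "prob_space ?P"
    by (intro prob_spaceI)
       (simp add: space_point_measure emeasure_point_measure_finite[OF finite_spec] sum_ennreal)
  then have "prob_space (cumulative_measure W K)"
    unfolding cumulative_measure_def
    by (rule prob_space.prob_space_distr) (simp add: measurable_def space_point_measure sets_point_measure)
  then show ?thesis
    by (simp add: real_distribution_def real_distribution_axioms_def cumulative_measure_def)
qed

lemma AE_cumulative_measure: "AE t in cumulative_measure W K. \<bar>t\<bar> \<le> 1"
proof -
  have "(\<lambda>t. t) \<in> measurable (point_measure (spec W K) (\<lambda>t. ennreal (real (mult W K t) / real (card W)))) borel"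
    by (simp add: measurable_def space_point_measure sets_point_measure)
  then show ?thesis unfolding cumulative_measure_def
    using eigenvalue_bound by (subst AE_distr_iff) (auto intro!: AE_I2 simp: space_point_measure)
qed

lemma moment_cumulative_measure:
  "(\<integral>t. t ^ n \<partial>cumulative_measure W K) = (\<Sum>x\<in>W. (oper ^^ n) (point_mass x) x) / real (card W)"
  by (simp add: integral_cumulative_measure trace_power)

end

section \<open>The method of moments on a bounded interval\<close>

lemma (in real_distribution) char_moment_expansion:
  assumes "AE t in M. \<bar>t\<bar> \<le> 1"
  shows "cmod (char M s - (\<Sum>k\<le>n. ((\<i> * s) ^ k / fact k) * expectation (\<lambda>t. t ^ k)))
    \<le> 2 * \<bar>s\<bar> ^ n / fact n"
proof -
  have int: "integrable M (\<lambda>t. t ^ k)" for k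
    using assms by (intro integrable_const_bound[of _ 1]) (auto simp: power_abs power_le_one)
  have int_abs: "integrable M (\<lambda>t. \<bar>t\<bar> ^ k)" for k
    using assms by (intro integrable_const_bound[of _ 1]) (auto simp: power_le_one)
  have "expectation (\<lambda>t. \<bar>t\<bar> ^ n) \<le> expectation (\<lambda>t. 1)"
    using assms by (intro integral_mono_AE int_abs) (auto simp: power_le_one)
  then have "(2 * \<bar>s\<bar> ^ n / fact n) * expectation (\<lambda>t. \<bar>t\<bar> ^ n) \<le> (2 * \<bar>s\<bar> ^ n / fact n) * 1"
    using prob_space by (intro mult_left_mono) simp_all
  with char_approx1[of n s, OF int] show ?thesis by simp
qed

text \<open>
  For distributions on \<open>[-1,1]\<close> the Taylor polynomial of the characteristic function at \<open>s\<close> has moments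
  as coefficients and an error \<open>2 |s|\<^sup>n / n!\<close> that does not depend on the distribution. Convergence of
  moments thus gives pointwise convergence of characteristic functions, and Levy's theorem applies.
\<close>

theorem weak_conv_from_moments:
  assumes M: "\<And>n. real_distribution (M n)" "\<And>n. AE t in M n. \<bar>t\<bar> \<le> 1"
    and L: "real_distribution L" "AE t in L. \<bar>t\<bar> \<le> 1"
    and moments: "\<And>k. (\<lambda>n. \<integral>t. t ^ k \<partial>M n) \<longlonglongrightarrow> (\<integral>t. t ^ k \<partial>L)"
  shows "weak_conv_m M L"
proof (rule levy_continuity[OF M(1) L(1)])
  fix s :: real
  define T where "T = (\<lambda>N (Q :: real measure). \<Sum>k\<le>N. ((\<i> * s) ^ k / fact k) * complex_of_real (\<integral>t. t ^ k \<partial>Q))"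
  show "(\<lambda>n. char (M n) s) \<longlonglongrightarrow> char L s"
  proof (rule LIMSEQ_I)
    fix r :: real assume r: "0 < r"
    have "(\<lambda>n. inverse (fact n) * \<bar>s\<bar> ^ n) \<longlonglongrightarrow> 0"
      by (rule summable_LIMSEQ_zero[OF summable_exp])
    then have "(\<lambda>n. 2 * \<bar>s\<bar> ^ n / fact n) \<longlonglongrightarrow> 0"
      by (drule_tac tendsto_mult_right_zero[of _ _ 2]) (simp add: field_simps)
    then have "\<forall>\<^sub>F n in sequentially. 2 * \<bar>s\<bar> ^ n / fact n < r / 3"
      by (rule order_tendstoD(2)) (use r in simp)
    then obtain N where N: "2 * \<bar>s\<bar> ^ N / fact N < r / 3"
      by (auto simp: eventually_sequentially)
    have "(\<lambda>n. T N (M n)) \<longlonglongrightarrow> T N L"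
      unfolding T_def by (intro tendsto_intros moments)
    then obtain n0 where n0: "\<And>n. n \<ge> n0 \<Longrightarrow> norm (T N (M n) - T N L) < r / 3"
      using LIMSEQ_D[of "\<lambda>n. T N (M n)" "T N L" "r / 3"] r by auto
    show "\<exists>no. \<forall>n\<ge>no. norm (char (M n) s - char L s) < r"
    proof (intro exI allI impI)
      fix n assume n: "n \<ge> n0"
      have a: "norm (char (M n) s - T N (M n)) < r / 3"
        using real_distribution.char_moment_expansion[OF M(1)[of n] M(2)[of n], of s N] N
        unfolding T_def by linarith
      have b: "norm (char L s - T N L) < r / 3"
        using real_distribution.char_moment_expansion[OF L, of s N] N
        unfolding T_def by linarith
      have "char (M n) s - char L s =
          (char (M n) s - T N (M n)) + (T N (M n) - T N L) - (char L s - T N L)" by simp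
      then have "norm (char (M n) s - char L s) \<le>
          norm (char (M n) s - T N (M n)) + norm (T N (M n) - T N L) + norm (char L s - T N L)"
        by (simp only:) (intro order_trans[OF norm_triangle_ineq4] add_right_mono norm_triangle_ineq)
      then show "norm (char (M n) s - char L s) < r" using a b n0[OF n] by linarith
    qed
  qed
qed

text \<open>
  Weak convergence only tests bounded functions; on \<open>[-1,1]\<close> the square agrees with \<open>min 1 (t\<^sup>2)\<close>.
\<close>

lemma second_moment_weak_conv:
  assumes M: "\<And>n. real_distribution (M n)" "\<And>n. AE t in M n. \<bar>t\<bar> \<le> 1"
    and L: "real_distribution L" "AE t in L. \<bar>t\<bar> \<le> 1"
    and conv: "weak_conv_m M L"
  shows "(\<lambda>n. \<integral>t. t\<^sup>2 \<partial>M n) \<longlonglongrightarrow> (\<integral>t. t\<^sup>2 \<partial>L)"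
proof -
  have eq: "(\<integral>t. min 1 (t\<^sup>2) \<partial>Q) = (\<integral>t. t\<^sup>2 \<partial>Q)"
    if Q: "real_distribution Q" "AE t in Q. \<bar>t\<bar> \<le> 1" for Q :: "real measure"
  proof (rule integral_cong_AE)
    interpret real_distribution Q by fact
    show "(\<lambda>t. min 1 (t\<^sup>2)) \<in> borel_measurable Q" "(\<lambda>t. t\<^sup>2) \<in> borel_measurable Q" by simp_all
    show "AE t in Q. min 1 (t\<^sup>2) = t\<^sup>2" using Q(2) by eventually_elim (simp add: abs_square_le_1 min_absorb2)
  qed
  have "(\<lambda>n. \<integral>t. min 1 (t\<^sup>2) \<partial>M n) \<longlonglongrightarrow> (\<integral>t. min 1 (t\<^sup>2) \<partial>L)"
    by (rule weak_conv_imp_integral_bdd_continuous_conv[OF M(1) L(1) conv, where B = 1])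
       (auto intro!: continuous_intros)
  then show ?thesis by (simp only: eq[OF M] eq[OF L])
qed

section \<open>Integration against a sum of two measures\<close>

text \<open>
  The sum of measures is given through its values on sets, the form in which the spectral measure of a sum
  of two vectors decomposes.
\<close>

lemma nn_integral_measure_sum:
  fixes M M1 M2 :: "'a measure"
  assumes sets: "sets M1 = sets M" "sets M2 = sets M"
    and sum: "\<And>A. A \<in> sets M \<Longrightarrow> emeasure M A = emeasure M1 A + emeasure M2 A"
    and f: "f \<in> borel_measurable M"
  shows "(\<integral>\<^sup>+t. f t \<partial>M) = (\<integral>\<^sup>+t. f t \<partial>M1) + (\<integral>\<^sup>+t. f t \<partial>M2)"
  using f
proof (induction rule: borel_measurable_induct)
  case (cong f g)
  have "space M1 = space M" "space M2 = space M" using sets by (auto dest: sets_eq_imp_space_eq)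
  then have "(\<integral>\<^sup>+t. f t \<partial>M1) = (\<integral>\<^sup>+t. g t \<partial>M1)" "(\<integral>\<^sup>+t. f t \<partial>M2) = (\<integral>\<^sup>+t. g t \<partial>M2)"
    using cong by (auto intro: nn_integral_cong)
  then show ?case using cong by (simp cong: nn_integral_cong)
next
  case (set A)
  then show ?case using sets sum by simp
next
  case (mult u c)
  then have "u \<in> borel_measurable M1" "u \<in> borel_measurable M2"
    using sets by (simp_all cong: measurable_cong_sets)
  then show ?case using mult by (simp add: nn_integral_cmult distrib_left)
next
  case (add u v)
  then have "u \<in> borel_measurable M1" "u \<in> borel_measurable M2"
    "v \<in> borel_measurable M1" "v \<in> borel_measurable M2"
    using sets by (simp_all cong: measurable_cong_sets)
  then show ?case using add by (simp add: nn_integral_add ac_simps)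
next
  case (seq U)
  have meas: "\<And>i. U i \<in> borel_measurable M1" "\<And>i. U i \<in> borel_measurable M2"
    using seq sets by (simp_all cong: measurable_cong_sets)
  have inc: "incseq (\<lambda>i. \<integral>\<^sup>+t. U i t \<partial>M1)" "incseq (\<lambda>i. \<integral>\<^sup>+t. U i t \<partial>M2)"
    using seq by (auto simp: incseq_def le_fun_def intro!: nn_integral_mono)
  have "(\<integral>\<^sup>+t. (SUP i. U i) t \<partial>Q) = (SUP i. \<integral>\<^sup>+t. U i t \<partial>Q)"
    if "\<And>i. U i \<in> borel_measurable Q" for Q
    using nn_integral_monotone_convergence_SUP[OF \<open>incseq U\<close> that] by (simp add: image_comp)
  then show ?case using seq meas ennreal_SUP_add[OF inc] by simp
qed

lemma integral_measure_sum:
  fixes f :: "'a \<Rightarrow> real"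
  assumes sets: "sets M1 = sets M" "sets M2 = sets M"
    and sum: "\<And>A. A \<in> sets M \<Longrightarrow> emeasure M A = emeasure M1 A + emeasure M2 A"
    and int: "integrable M f" "integrable M1 f" "integrable M2 f"
  shows "(\<integral>t. f t \<partial>M) = (\<integral>t. f t \<partial>M1) + (\<integral>t. f t \<partial>M2)"
proof -
  have split: "enn2real (\<integral>\<^sup>+t. ennreal (g t) \<partial>M) =
      enn2real (\<integral>\<^sup>+t. ennreal (g t) \<partial>M1) + enn2real (\<integral>\<^sup>+t. ennreal (g t) \<partial>M2)"
    if g: "integrable M g" "integrable M1 g" "integrable M2 g" for g :: "'a \<Rightarrow> real"
  proof -
    have fin: "(\<integral>\<^sup>+t. ennreal (g t) \<partial>Q) < \<infinity>" if "integrable Q g" for Q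
    proof -
      have "(\<integral>\<^sup>+t. ennreal (g t) \<partial>Q) \<le> (\<integral>\<^sup>+t. ennreal (norm (g t)) \<partial>Q)"
        by (intro nn_integral_mono ennreal_leI) simp
      then show ?thesis using that by (auto simp: integrable_iff_bounded intro: le_less_trans)
    qed
    have "(\<integral>\<^sup>+t. ennreal (g t) \<partial>M) = (\<integral>\<^sup>+t. ennreal (g t) \<partial>M1) + (\<integral>\<^sup>+t. ennreal (g t) \<partial>M2)"
      using g(1) by (intro nn_integral_measure_sum[OF sets sum]) auto
    then show ?thesis using fin[OF g(2)] fin[OF g(3)] by (simp add: enn2real_plus)
  qed
  show ?thesis
    using split[OF int] split[of "\<lambda>t. - f t"] int by (simp add: real_lebesgue_integral_def)
qed

section \<open>Square-summable functions\<close>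

lemma ell2_iff: "f \<in> ell2 \<longleftrightarrow> (\<lambda>x. (cmod (f x))\<^sup>2) summable_on UNIV"
  by (simp add: ell2_def)

lemma ell2_product_summable:
  assumes "f \<in> ell2" "g \<in> ell2"
  shows "(\<lambda>x. norm (cnj (f x) * g x)) summable_on UNIV"
proof (rule Infinite_Sum.abs_summable_on_comparison_test')
  show "(\<lambda>x. (cmod (f x))\<^sup>2 + (cmod (g x))\<^sup>2) summable_on UNIV"
    using assms by (intro summable_on_add) (simp_all add: ell2_iff)
  fix x
  have "2 * (cmod (f x) * cmod (g x)) \<le> (cmod (f x))\<^sup>2 + (cmod (g x))\<^sup>2"
    using sum_squares_bound[of "cmod (f x)" "cmod (g x)"] by simp
  moreover have "0 \<le> cmod (f x) * cmod (g x)" by simp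
  ultimately have "cmod (f x) * cmod (g x) \<le> (cmod (f x))\<^sup>2 + (cmod (g x))\<^sup>2" by linarith
  then show "norm (cnj (f x) * g x) \<le> (cmod (f x))\<^sup>2 + (cmod (g x))\<^sup>2" by (simp add: norm_mult)
qed

lemma ell2_product_summable': "f \<in> ell2 \<Longrightarrow> g \<in> ell2 \<Longrightarrow> (\<lambda>x. cnj (f x) * g x) summable_on UNIV"
  by (rule abs_summable_summable[OF ell2_product_summable])

lemma ell2_scale: "f \<in> ell2 \<Longrightarrow> (\<lambda>x. a * f x) \<in> ell2"
  by (auto simp: ell2_iff norm_mult power_mult_distrib intro: summable_on_cmult_right)

lemma ell2_add:
  assumes "f \<in> ell2" "g \<in> ell2"
  shows "(\<lambda>x. f x + g x) \<in> ell2"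
  unfolding ell2_iff
proof (rule summable_on_comparison_test)
  show "(\<lambda>x. 2 * (cmod (f x))\<^sup>2 + 2 * (cmod (g x))\<^sup>2) summable_on UNIV"
    using assms by (intro summable_on_add summable_on_cmult_right) (simp_all add: ell2_iff)
  fix x
  have "(cmod (f x + g x))\<^sup>2 \<le> (cmod (f x) + cmod (g x))\<^sup>2"
    by (intro power_mono norm_triangle_ineq) simp
  also have "\<dots> \<le> 2 * (cmod (f x))\<^sup>2 + 2 * (cmod (g x))\<^sup>2"
    using sum_squares_bound[of "cmod (f x)" "cmod (g x)"] by (simp add: power2_sum)
  finally show "(cmod (f x + g x))\<^sup>2 \<le> 2 * (cmod (f x))\<^sup>2 + 2 * (cmod (g x))\<^sup>2" .
qed simp

lemma ell2_lincomb: "f \<in> ell2 \<Longrightarrow> g \<in> ell2 \<Longrightarrow> (\<lambda>x. a * f x + b * g x) \<in> ell2"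
  by (intro ell2_add ell2_scale)

lemma ell2_inner_lincomb_right:
  assumes "f \<in> ell2" "g \<in> ell2" "h \<in> ell2"
  shows "ell2_inner h (\<lambda>x. a * f x + b * g x) = a * ell2_inner h f + b * ell2_inner h g"
proof -
  have "ell2_inner h (\<lambda>x. a * f x + b * g x) =
      (\<Sum>\<^sub>\<infinity>x. a * (cnj (h x) * f x) + b * (cnj (h x) * g x))"
    by (simp add: ell2_inner_def algebra_simps)
  also have "\<dots> = (\<Sum>\<^sub>\<infinity>x. a * (cnj (h x) * f x)) + (\<Sum>\<^sub>\<infinity>x. b * (cnj (h x) * g x))"
    using assms by (intro infsum_add summable_on_cmult_right ell2_product_summable')
  also have "\<dots> = a * ell2_inner h f + b * ell2_inner h g"
    using assms by (simp add: ell2_inner_def infsum_cmult_right ell2_product_summable')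
  finally show ?thesis .
qed

lemma ell2_inner_cnj: "cnj (ell2_inner f g) = ell2_inner g f"
  by (simp add: ell2_inner_def flip: infsum_cnj) (simp add: mult.commute)

lemma Re_ell2_inner_commute: "Re (ell2_inner g f) = Re (ell2_inner f g)"
  using arg_cong[OF ell2_inner_cnj[of f g], of Re] by simp

lemma ell2_inner_lincomb_left:
  assumes "f \<in> ell2" "g \<in> ell2" "h \<in> ell2"
  shows "ell2_inner (\<lambda>x. a * f x + b * g x) h = cnj a * ell2_inner f h + cnj b * ell2_inner g h"
proof -
  have "cnj (ell2_inner h (\<lambda>x. a * f x + b * g x)) = cnj a * ell2_inner f h + cnj b * ell2_inner g h"
    using assms by (simp add: ell2_inner_lincomb_right ell2_inner_cnj)
  then show ?thesis by (simp add: ell2_inner_cnj)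
qed

lemma infsum_of_real_complex: "(\<Sum>\<^sub>\<infinity>x\<in>A. complex_of_real (f x)) = of_real (\<Sum>\<^sub>\<infinity>x\<in>A. f x)"
proof (cases "f summable_on A")
  case True
  then show ?thesis by (intro infsumI) (simp add: has_sum_of_real)
next
  case False
  then have "\<not> (\<lambda>x. complex_of_real (f x)) summable_on A"
    using summable_on_Re[of "\<lambda>x. complex_of_real (f x)" A] by auto
  then show ?thesis using False by (simp add: infsum_not_exists)
qed

lemma ell2_inner_self: "ell2_inner f f = of_real (\<Sum>\<^sub>\<infinity>x. (cmod (f x))\<^sup>2)"
proof -
  have "ell2_inner f f = (\<Sum>\<^sub>\<infinity>x. of_real ((cmod (f x))\<^sup>2))"
    by (simp only: ell2_inner_def complex_norm_square mult.commute)
  then show ?thesis by (simp only: infsum_of_real_complex)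
qed

lemma ell2_inner_self_nonneg: "0 \<le> Re (ell2_inner f f)"
  by (simp add: ell2_inner_self infsum_nonneg)

lemma ell2_inner_self_eq_0:
  assumes "f \<in> ell2" "Re (ell2_inner f f) = 0"
  shows "f = (\<lambda>x. 0)"
proof
  fix x
  have "(cmod (f x))\<^sup>2 = 0"
    using assms by (intro nonneg_infsum_le_0D[of "\<lambda>x. (cmod (f x))\<^sup>2" UNIV]) (simp_all add: ell2_inner_self ell2_iff)
  then show "f x = 0" by simp
qed

text \<open>
  Both \<open>\<parallel>f + g\<parallel>\<^sup>2\<close> and \<open>\<parallel>f - g\<parallel>\<^sup>2\<close> are nonnegative. This form of the Cauchy-Schwarz inequality is enough to
  bound \<open>\<langle>f, T f\<rangle>\<close> by \<open>\<parallel>f\<parallel>\<^sup>2\<close> for a contraction \<open>T\<close>.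
\<close>

lemma ell2_inner_bound:
  assumes "f \<in> ell2" "g \<in> ell2"
  shows "\<bar>Re (ell2_inner f g)\<bar> \<le> (Re (ell2_inner f f) + Re (ell2_inner g g)) / 2"
proof -
  have plus: "0 \<le> Re (ell2_inner f f) + 2 * Re (ell2_inner f g) + Re (ell2_inner g g)"
  proof -
    have "Re (ell2_inner (\<lambda>x. 1 * f x + 1 * g x) (\<lambda>x. 1 * f x + 1 * g x)) =
        Re (ell2_inner f f) + Re (ell2_inner f g) + Re (ell2_inner g f) + Re (ell2_inner g g)"
      using assms by (simp only: ell2_inner_lincomb_left ell2_inner_lincomb_right ell2_lincomb) simp
    moreover have "Re (ell2_inner g f) = Re (ell2_inner f g)" by (rule Re_ell2_inner_commute)
    ultimately show ?thesis using ell2_inner_self_nonneg[of "\<lambda>x. 1 * f x + 1 * g x"] by linarith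
  qed
  have minus: "0 \<le> Re (ell2_inner f f) - 2 * Re (ell2_inner f g) + Re (ell2_inner g g)"
  proof -
    have "Re (ell2_inner (\<lambda>x. 1 * f x + (-1) * g x) (\<lambda>x. 1 * f x + (-1) * g x)) =
        Re (ell2_inner f f) - Re (ell2_inner f g) - Re (ell2_inner g f) + Re (ell2_inner g g)"
      using assms by (simp only: ell2_inner_lincomb_left ell2_inner_lincomb_right ell2_lincomb) simp
    moreover have "Re (ell2_inner g f) = Re (ell2_inner f g)" by (rule Re_ell2_inner_commute)
    ultimately show ?thesis using ell2_inner_self_nonneg[of "\<lambda>x. 1 * f x + (-1) * g x"] by linarith
  qed
  show ?thesis using plus minus by (simp add: abs_le_iff)
qed

lemma delta_ell2: "delta v \<in> ell2"
  unfolding ell2_iff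
  by (rule finite_nonzero_values_imp_summable_on, rule finite_subset[of _ "{v}"]) (auto simp: delta_def)

lemma ell2_inner_delta: "ell2_inner (delta v) f = f v"
proof -
  have "ell2_inner (delta v) f = (\<Sum>\<^sub>\<infinity>x\<in>{v}. cnj (delta v x) * f x)"
    unfolding ell2_inner_def by (rule infsum_cong_neutral) (auto simp: delta_def)
  then show ?thesis by (simp add: delta_def)
qed

section \<open>Moments of a resolution of the identity\<close>

locale contraction_resolution =
  fixes T :: "('v \<Rightarrow> complex) \<Rightarrow> 'v \<Rightarrow> complex"
    and E :: "real set \<Rightarrow> ('v \<Rightarrow> complex) \<Rightarrow> 'v \<Rightarrow> complex"
  assumes T_ell2: "f \<in> ell2 \<Longrightarrow> T f \<in> ell2"
    and T_lincomb: "f \<in> ell2 \<Longrightarrow> g \<in> ell2 \<Longrightarrow>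
      T (\<lambda>x. a * f x + b * g x) = (\<lambda>x. a * T f x + b * T g x)"
    and T_contraction: "f \<in> ell2 \<Longrightarrow> Re (ell2_inner (T f) (T f)) \<le> Re (ell2_inner f f)"
    and resolution: "resolution_of_identity T E"
begin

abbreviation \<mu> :: "('v \<Rightarrow> complex) \<Rightarrow> real measure" where
  "\<mu> \<equiv> diagonal_measure E"

definition mass :: "('v \<Rightarrow> complex) \<Rightarrow> real set \<Rightarrow> real" where
  "mass f A = Re (ell2_inner f (E A f))"

lemma pvm: "projection_valued_measure E"
  using resolution by (simp add: resolution_of_identity_def)

lemma E_ell2: "A \<in> sets borel \<Longrightarrow> f \<in> ell2 \<Longrightarrow> E A f \<in> ell2"
  using pvm by (simp add: projection_valued_measure_def orthogonal_projection_def)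

lemma E_lincomb: "A \<in> sets borel \<Longrightarrow> f \<in> ell2 \<Longrightarrow> g \<in> ell2 \<Longrightarrow>
    E A (\<lambda>x. a * f x + b * g x) = (\<lambda>x. a * E A f x + b * E A g x)"
  using pvm by (simp add: projection_valued_measure_def orthogonal_projection_def)

lemma E_self_adjoint: "A \<in> sets borel \<Longrightarrow> f \<in> ell2 \<Longrightarrow> g \<in> ell2 \<Longrightarrow>
    ell2_inner f (E A g) = ell2_inner (E A f) g"
  using pvm by (simp add: projection_valued_measure_def orthogonal_projection_def)

lemma E_Int: "A \<in> sets borel \<Longrightarrow> B \<in> sets borel \<Longrightarrow> f \<in> ell2 \<Longrightarrow> E A (E B f) = E (A \<inter> B) f"
  using pvm by (simp add: projection_valued_measure_def)

lemma E_empty: "f \<in> ell2 \<Longrightarrow> E {} f = (\<lambda>x. 0)"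
  using pvm by (simp add: projection_valued_measure_def)

lemma E_UNIV: "f \<in> ell2 \<Longrightarrow> E UNIV f = f"
  using pvm by (simp add: projection_valued_measure_def)

lemma E_sums:
  fixes A :: "nat \<Rightarrow> real set"
  assumes "f \<in> ell2" "g \<in> ell2" "range A \<subseteq> sets borel" "disjoint_family A"
  shows "(\<lambda>i. ell2_inner f (E (A i) g)) sums ell2_inner f (E (\<Union>i. A i) g)"
  using pvm assms by (simp add: projection_valued_measure_def)

lemma mass_eq: "A \<in> sets borel \<Longrightarrow> f \<in> ell2 \<Longrightarrow> mass f A = Re (ell2_inner (E A f) (E A f))"
  using E_self_adjoint[of A f "E A f"] by (simp add: mass_def E_Int E_ell2)

lemma mass_nonneg: "A \<in> sets borel \<Longrightarrow> f \<in> ell2 \<Longrightarrow> 0 \<le> mass f A"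
  by (simp add: mass_eq ell2_inner_self_nonneg)

lemma sets_diagonal [measurable_cong, simp]: "sets (\<mu> f) = sets borel"
  using sets.sigma_sets_eq[of "borel :: real measure"]
  by (simp add: diagonal_measure_def)

lemma space_diagonal [simp]: "space (\<mu> f) = UNIV"
  using sets_eq_imp_space_eq[OF sets_diagonal] by simp

lemma emeasure_diagonal:
  assumes f: "f \<in> ell2" and A: "A \<in> sets borel"
  shows "emeasure (\<mu> f) A = ennreal (mass f A)"
  unfolding diagonal_measure_def mass_def
proof (rule emeasure_measure_of_sigma)
  show "sigma_algebra UNIV (sets (borel :: real measure))"
    using sets.sigma_algebra_axioms[of "borel :: real measure"] by simp
  show "positive (sets borel) (\<lambda>A. ennreal (Re (ell2_inner f (E A f))))"
    using f by (simp add: positive_def E_empty ell2_inner_def)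
  show "countably_additive (sets borel) (\<lambda>A. ennreal (Re (ell2_inner f (E A f))))"
  proof (rule countably_additiveI)
    fix A :: "nat \<Rightarrow> real set"
    assume A: "range A \<subseteq> sets borel" "disjoint_family A"
    have "(\<lambda>i. Re (ell2_inner f (E (A i) f))) sums Re (ell2_inner f (E (\<Union>i. A i) f))"
      by (rule sums_Re[OF E_sums[OF f f A]])
    then show "(\<Sum>i. ennreal (Re (ell2_inner f (E (A i) f)))) = ennreal (Re (ell2_inner f (E (\<Union>i. A i) f)))"
      using A(1) mass_nonneg f unfolding mass_def by (intro suminf_ennreal_eq) auto
  qed
qed fact

lemma finite_diagonal: "f \<in> ell2 \<Longrightarrow> finite_measure (\<mu> f)"
  by (intro finite_measureI) (simp add: emeasure_diagonal)

lemma measure_diagonal: "f \<in> ell2 \<Longrightarrow> A \<in> sets borel \<Longrightarrow> measure (\<mu> f) A = mass f A"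
  by (simp add: measure_def emeasure_diagonal mass_nonneg)

lemma mass_UNIV: "f \<in> ell2 \<Longrightarrow> mass f UNIV = Re (ell2_inner f f)"
  by (simp add: mass_def E_UNIV)

lemma diagonal_eqI:
  assumes "f \<in> ell2" "sets M = sets borel" "\<And>A. A \<in> sets borel \<Longrightarrow> emeasure M A = ennreal (mass f A)"
  shows "\<mu> f = M"
  using assms by (intro measure_eqI) (simp_all add: emeasure_diagonal)

lemma mean_integrable: "f \<in> ell2 \<Longrightarrow> integrable (\<mu> f) (\<lambda>t. t)"
  using resolution by (simp add: resolution_of_identity_def)

lemma mean: "f \<in> ell2 \<Longrightarrow> ell2_inner f (T f) = of_real (\<integral>t. t \<partial>\<mu> f)"
  using resolution by (simp add: resolution_of_identity_def)

text \<open>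
  The form \<open>\<langle>h, T h\<rangle>\<close> is the mean of a real measure, hence real; polarising with \<open>f + g\<close> and \<open>f + \<i> g\<close>
  gives symmetry.
\<close>

lemma T_self_adjoint:
  assumes f: "f \<in> ell2" and g: "g \<in> ell2"
  shows "ell2_inner f (T g) = ell2_inner (T f) g"
proof -
  have expand: "ell2_inner (\<lambda>x. 1 * f x + b * g x) (T (\<lambda>x. 1 * f x + b * g x)) =
      ell2_inner f (T f) + b * ell2_inner f (T g) + cnj b * ell2_inner g (T f)
        + cnj b * b * ell2_inner g (T g)" for b
    using assms
    by (simp only: T_lincomb ell2_inner_lincomb_left ell2_inner_lincomb_right T_ell2 ell2_lincomb)
       (simp add: algebra_simps)
  have real: "Im (ell2_inner h (T h)) = 0" if "h \<in> ell2" for h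
    using mean[OF that] by simp
  have "Im (ell2_inner f (T g)) + Im (ell2_inner g (T f)) = 0"
    using arg_cong[OF expand[of 1], of Im] real[OF f] real[OF g] real[OF ell2_lincomb[OF f g, of 1 1]]
    by simp
  moreover have "Re (ell2_inner f (T g)) - Re (ell2_inner g (T f)) = 0"
    using arg_cong[OF expand[of \<i>], of Im] real[OF f] real[OF g] real[OF ell2_lincomb[OF f g, of 1 \<i>]]
    by simp
  ultimately have "ell2_inner f (T g) = cnj (ell2_inner g (T f))"
    by (simp add: complex_eq_iff)
  then show ?thesis by (simp add: ell2_inner_cnj)
qed

lemma E_range_orthogonal:
  assumes "f \<in> ell2" "g \<in> ell2" "A \<in> sets borel" "B \<in> sets borel"
  shows "ell2_inner (E A f) (E B (E (- A) g)) = 0"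
proof -
  have "ell2_inner (E A f) (E B (E (- A) g)) = ell2_inner f (E A (E B (E (- A) g)))"
    using assms by (simp add: E_self_adjoint E_ell2)
  also have "E A (E B (E (- A) g)) = E {} g"
    using assms by (simp add: E_Int Int_left_commute)
  finally show ?thesis using assms by (simp add: E_empty ell2_inner_def)
qed

text \<open>
  For \<open>p\<close> in the range of \<open>E A\<close> and \<open>q\<close> in the range of \<open>E (- A)\<close> the cross terms of the spectral measure
  of \<open>p + q\<close> vanish, so \<open>p + q\<close> and \<open>p - q\<close> have the same spectral measure. Their means agree as
  well, and the difference of the means is \<open>4 * Re \<langle>p, T q\<rangle>\<close>. The imaginary part follows by
  replacing \<open>p\<close> by \<open>\<i> p\<close>, which is why the real part is treated for every \<open>f\<close> first.
\<close>

lemma T_preserves_orthogonality: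
  assumes f: "f \<in> ell2" and g: "g \<in> ell2" and A: "A \<in> sets borel"
  shows "ell2_inner (E A f) (T (E (- A) g)) = 0"
proof -
  have Re_0: "Re (ell2_inner (E A f) (T (E (- A) g))) = 0" if f: "f \<in> ell2" for f
  proof -
    define p where "p = E A f"
    define q where "q = E (- A) g"
    have pq: "p \<in> ell2" "q \<in> ell2" using f g A by (simp_all add: p_def q_def E_ell2)
    have orth: "ell2_inner p (E B q) = 0" "ell2_inner q (E B p) = 0" if "B \<in> sets borel" for B
    proof -
      show 1: "ell2_inner p (E B q) = 0"
        unfolding p_def q_def using E_range_orthogonal[OF f g A that] .
      have "cnj (ell2_inner q (E B p)) = ell2_inner p (E B q)"
        using pq that by (simp add: ell2_inner_cnj E_self_adjoint)
      then show "ell2_inner q (E B p) = 0" using 1 by simp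
    qed
    define h where "h = (\<lambda>c x. 1 * p x + c * q x)"
    have h: "h c \<in> ell2" for c unfolding h_def by (rule ell2_lincomb[OF pq])
    have mass_h: "mass (h c) B = mass p B + (cmod c)\<^sup>2 * mass q B" if "B \<in> sets borel" for c B
    proof -
      have "ell2_inner (h c) (E B (h c)) =
          ell2_inner p (E B p) + c * cnj c * ell2_inner q (E B q)"
        using pq that orth[OF that] unfolding h_def
        by (simp only: E_lincomb ell2_inner_lincomb_left ell2_inner_lincomb_right E_ell2 ell2_lincomb)
           (simp add: algebra_simps)
      then show ?thesis by (simp add: mass_def flip: complex_norm_square)
    qed
    have "\<mu> (h 1) = \<mu> (h (-1))"
      using h mass_h by (intro diagonal_eqI) (simp_all add: emeasure_diagonal[OF h])
    then have "ell2_inner (h 1) (T (h 1)) = ell2_inner (h (-1)) (T (h (-1)))"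
      using mean[OF h] by simp
    moreover have "ell2_inner (h c) (T (h c)) = ell2_inner p (T p) + c * ell2_inner p (T q)
        + cnj c * ell2_inner q (T p) + cnj c * c * ell2_inner q (T q)" for c
      unfolding h_def using pq
      by (simp only: T_lincomb ell2_inner_lincomb_left ell2_inner_lincomb_right T_ell2 ell2_lincomb)
         (simp add: algebra_simps)
    ultimately have "2 * ell2_inner q (T p) + 2 * ell2_inner p (T q) = 0"
      by (simp add: eq_neg_iff_add_eq_0)
    then have "Re (ell2_inner q (T p)) + Re (ell2_inner p (T q)) = 0"
      by (auto dest!: arg_cong[of _ _ Re])
    moreover have "Re (ell2_inner q (T p)) = Re (ell2_inner p (T q))"
      using T_self_adjoint[OF pq(2) pq(1)] Re_ell2_inner_commute[of "T q" p] by simp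
    ultimately show ?thesis by (simp add: p_def q_def)
  qed
  have "E A (\<lambda>x. \<i> * f x + 0 * f x) = (\<lambda>x. \<i> * E A f x + 0 * E A f x)"
    using f A by (simp only: E_lincomb)
  then have "ell2_inner (E A (\<lambda>x. \<i> * f x + 0 * f x)) (T (E (- A) g)) =
      - \<i> * ell2_inner (E A f) (T (E (- A) g))"
    using f g A by (simp only: ell2_inner_lincomb_left T_ell2 E_ell2 borel_comp) simp
  moreover have "Re (ell2_inner (E A (\<lambda>x. \<i> * f x + 0 * f x)) (T (E (- A) g))) = 0"
    using f by (intro Re_0 ell2_lincomb)
  ultimately have "Im (ell2_inner (E A f) (T (E (- A) g))) = 0" by simp
  then show ?thesis using Re_0[OF f] by (simp add: complex_eq_iff)
qed

text \<open>
  Countable additivity is a statement about inner products \<open>\<langle>u, E(A) f\<rangle>\<close>. Taking for \<open>u\<close> the difference of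
  the two sides shows that \<open>u\<close> is orthogonal to itself.
\<close>

lemma E_Compl_decomposition:
  assumes f: "f \<in> ell2" and A: "A \<in> sets borel"
  shows "f = (\<lambda>x. 1 * E A f x + 1 * E (- A) f x)"
proof -
  define p where "p = (\<lambda>x. 1 * E A f x + 1 * E (- A) f x)"
  have p: "p \<in> ell2" unfolding p_def using f A by (intro ell2_lincomb E_ell2) auto
  define u where "u = (\<lambda>x. 1 * f x + (-1) * p x)"
  have u: "u \<in> ell2" unfolding u_def by (rule ell2_lincomb[OF f p])
  have ran: "range (binaryset A (- A)) \<subseteq> sets borel" using A by (auto simp: range_binaryset_eq)
  have "disjoint_family (binaryset A (- A))"
    by (auto simp: disjoint_family_on_def binaryset_def)
  from E_sums[OF u f ran this]
  have "(\<lambda>i. ell2_inner u (E (binaryset A (- A) i) f)) sums ell2_inner u (E UNIV f)"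
    by (simp add: UN_binaryset_eq)
  moreover have "(\<lambda>i. ell2_inner u (E (binaryset A (- A) i) f)) sums
      (ell2_inner u (E A f) + ell2_inner u (E (- A) f))"
    by (rule binaryset_sums) (simp add: E_empty f ell2_inner_def)
  ultimately have "ell2_inner u f = ell2_inner u (E A f) + ell2_inner u (E (- A) f)"
    using sums_unique2 by (fastforce simp: E_UNIV f)
  also have "\<dots> = ell2_inner u p"
    unfolding p_def using u f A by (simp only: ell2_inner_lincomb_right E_ell2 borel_comp) simp
  finally have "ell2_inner u u = 0"
    by (subst (2) u_def) (simp only: ell2_inner_lincomb_right u f p, simp)
  then have "u = (\<lambda>x. 0)" using u by (intro ell2_inner_self_eq_0) simp_all
  then show ?thesis by (simp add: u_def p_def fun_eq_iff algebra_simps)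
qed

text \<open>
  With respect to the splitting into the ranges of \<open>E A\<close> and \<open>E (- A)\<close>, the operator \<open>T\<close> has no
  off-diagonal blocks.
\<close>

lemma E_T_commute:
  assumes f: "f \<in> ell2" and A: "A \<in> sets borel"
  shows "E A (T f) = T (E A f)"
proof -
  have off_diagonal: "E B (T (E (- B) f)) = (\<lambda>x. 0)" if B: "B \<in> sets borel" for B
  proof (rule ell2_inner_self_eq_0)
    let ?g = "T (E (- B) f)"
    have g: "?g \<in> ell2" using f B by (simp add: T_ell2 E_ell2)
    show "E B ?g \<in> ell2" using g B by (simp add: E_ell2)
    have "ell2_inner (E B ?g) (E B ?g) = ell2_inner (E B ?g) ?g"
      using g B by (simp add: E_self_adjoint E_ell2 E_Int)
    then show "Re (ell2_inner (E B ?g) (E B ?g)) = 0"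
      using T_preserves_orthogonality[OF g f B] by simp
  qed
  note ell2s = f A T_ell2 E_ell2 borel_comp
  have "E A (T f) = E A (T (\<lambda>x. 1 * E A f x + 1 * E (- A) f x))"
    using E_Compl_decomposition[OF f A] by simp
  also have "\<dots> = (\<lambda>x. 1 * E A (T (E A f)) x + 1 * E A (T (E (- A) f)) x)"
    by (simp only: T_lincomb E_lincomb ell2s)
  also have "\<dots> = (\<lambda>x. 1 * E A (T (E A f)) x + 1 * E (- A) (T (E A f)) x)"
    using off_diagonal[OF A] off_diagonal[of "- A"] A by simp
  also have "\<dots> = T (E A f)"
    by (rule E_Compl_decomposition[symmetric]) (simp_all add: ell2s)
  finally show ?thesis .
qed

lemma mass_E: "f \<in> ell2 \<Longrightarrow> A \<in> sets borel \<Longrightarrow> B \<in> sets borel \<Longrightarrow> mass (E A f) B = mass f (A \<inter> B)"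
  by (simp add: mass_eq E_ell2 E_Int Int_commute)

lemma diagonal_E:
  assumes "f \<in> ell2" "A \<in> sets borel"
  shows "\<mu> (E A f) = density (\<mu> f) (\<lambda>t. ennreal (indicator A t))"
proof (rule diagonal_eqI)
  fix B :: "real set" assume B: "B \<in> sets borel"
  have "emeasure (density (\<mu> f) (\<lambda>t. ennreal (indicator A t))) B =
      (\<integral>\<^sup>+t. ennreal (indicator A t) * indicator B t \<partial>\<mu> f)"
    using assms B by (simp add: emeasure_density)
  also have "\<dots> = (\<integral>\<^sup>+t. indicator (A \<inter> B) t \<partial>\<mu> f)"
    by (intro nn_integral_cong) (simp add: indicator_def)
  finally have "emeasure (density (\<mu> f) (\<lambda>t. ennreal (indicator A t))) B = emeasure (\<mu> f) (A \<inter> B)"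
    using assms B by simp
  then show "emeasure (density (\<mu> f) (\<lambda>t. ennreal (indicator A t))) B = ennreal (mass (E A f) B)"
    using assms B by (simp add: emeasure_diagonal mass_E)
qed (use assms in \<open>simp_all add: E_ell2\<close>)

lemma integral_diagonal_E:
  fixes g :: "real \<Rightarrow> real"
  assumes "f \<in> ell2" "A \<in> sets borel" "g \<in> borel_measurable borel"
  shows "(\<integral>t. g t \<partial>\<mu> (E A f)) = (\<integral>t. indicator A t * g t \<partial>\<mu> f)"
  using assms by (simp add: diagonal_E integral_density)

lemma T_form_bound:
  assumes "f \<in> ell2"
  shows "\<bar>\<integral>t. t \<partial>\<mu> f\<bar> \<le> mass f UNIV"
  using ell2_inner_bound[of f "T f"] T_contraction[of f] T_ell2[of f] assms mean[of f]
  by (simp add: mass_UNIV)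

text \<open>
  If \<open>h\<close> lies in the range of \<open>E {1<..}\<close>, its spectral measure sits on \<open>t > 1\<close>, yet its mean
  \<open>\<langle>h, T h\<rangle>\<close> is at most its total mass \<open>\<parallel>h\<parallel>\<^sup>2\<close> because \<open>T\<close> is a contraction; this leaves only \<open>h = 0\<close>.
  The sign \<open>s\<close> treats \<open>t > 1\<close> and \<open>t < -1\<close> at once.
\<close>

lemma AE_diagonal:
  assumes f: "f \<in> ell2"
  shows "AE t in \<mu> f. \<bar>t\<bar> \<le> 1"
proof -
  have null: "mass f A = 0"
    if A: "A \<in> sets borel" and s: "\<bar>s\<bar> = 1" "\<And>t. t \<in> A \<Longrightarrow> 1 < s * t" for A s
  proof -
    define h where "h = E A f"
    have h: "h \<in> ell2" using f A by (simp add: h_def E_ell2)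
    interpret finite_measure "\<mu> h" by (rule finite_diagonal[OF h])
    have "measure (\<mu> h) (- A) = 0"
      using h f A by (simp add: measure_diagonal) (simp add: h_def mass_E, simp add: mass_def E_empty ell2_inner_def)
    then have "- A \<in> null_sets (\<mu> h)"
      using A by (simp add: null_sets_def emeasure_eq_measure)
    then have AE_A: "AE t in \<mu> h. 1 < s * t"
      by (rule AE_mp[OF AE_not_in]) (use s in auto)
    have int: "integrable (\<mu> h) (\<lambda>t. s * t - 1)"
      using mean_integrable[OF h] by simp
    have "(\<integral>t. s * t - 1 \<partial>\<mu> h) = s * (\<integral>t. t \<partial>\<mu> h) - mass h UNIV"
      using mean_integrable[OF h] h by (simp add: measure_diagonal)
    also have "\<dots> \<le> 0"
      using T_form_bound[OF h] s(1) abs_ge_self[of "s * (\<integral>t. t \<partial>\<mu> h)"] by (simp add: abs_mult)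
    finally have "(\<integral>t. s * t - 1 \<partial>\<mu> h) = 0"
      using AE_A by (intro antisym integral_nonneg_AE) auto
    then have "AE t in \<mu> h. s * t - 1 = 0"
      using AE_A by (subst integral_nonneg_eq_0_iff_AE[OF int, symmetric]) auto
    with AE_A have "AE t in \<mu> h. False" by eventually_elim simp
    then have "emeasure (\<mu> h) UNIV = 0"
      using AE_iff_measurable[of UNIV "\<mu> h" "\<lambda>_. False"] by simp
    then have "mass h UNIV = 0" using h by (simp add: emeasure_diagonal mass_nonneg)
    then show ?thesis using f A by (simp add: h_def mass_E)
  qed
  have "{1<..} \<in> null_sets (\<mu> f)" "{..<-1} \<in> null_sets (\<mu> f)"
    using null[of "{1<..}" 1] null[of "{..<-1}" "-1"] f by (auto simp: null_sets_def emeasure_diagonal)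
  then have "AE t in \<mu> f. t \<notin> {1<..}" "AE t in \<mu> f. t \<notin> {..<-1}" by (auto dest!: AE_not_in)
  then show ?thesis by eventually_elim auto
qed

lemma power_integrable: "f \<in> ell2 \<Longrightarrow> integrable (\<mu> f) (\<lambda>t. t ^ k)"
  using AE_diagonal[of f]
  by (intro finite_measure.integrable_const_bound[OF finite_diagonal, of _ _ 1])
     (auto simp: power_abs power_le_one)

text \<open>
  Because \<open>E B\<close> commutes with \<open>T\<close>, both sides are the mean of the spectral measure of \<open>E B h\<close>. Read as
  an identity of signed measures in \<open>B\<close>: the mixed spectral measure of \<open>h\<close> and \<open>T h\<close> has density \<open>t\<close>
  with respect to that of \<open>h\<close>.
\<close>

lemma mean_on:
  assumes h: "h \<in> ell2" and B: "B \<in> sets borel"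
  shows "Re (ell2_inner h (E B (T h))) = (\<integral>t. indicator B t * t \<partial>\<mu> h)"
proof -
  have "ell2_inner h (E B (T h)) = ell2_inner h (E B (E B (T h)))"
    using h B by (simp add: E_Int T_ell2)
  also have "\<dots> = ell2_inner (E B h) (E B (T h))"
    using h B by (intro E_self_adjoint E_ell2 T_ell2)
  also have "\<dots> = ell2_inner (E B h) (T (E B h))"
    using h B by (simp only: E_T_commute)
  finally show ?thesis
    using h B by (simp add: mean E_ell2 integral_diagonal_E)
qed

text \<open>
  With \<open>w = T h / 2\<close> and \<open>u = h + w\<close>, expanding \<open>\<langle>u, E(B) u\<rangle>\<close> and using \<open>mean_on\<close> for the cross terms gives
  \<open>\<mu>\<^sub>u = (1 + t) \<mu>\<^sub>h + \<mu>\<^sub>w\<close>. Taking means and expanding \<open>\<langle>u, T u\<rangle>\<close> on the left, the terms \<open>\<langle>h, T h\<rangle>\<close> and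
  \<open>\<langle>w, T w\<rangle>\<close> cancel, and what remains is \<open>\<parallel>T h\<parallel>\<^sup>2 = \<integral> t\<^sup>2 \<mu>\<^sub>h(dt)\<close>. The coefficient \<open>1/2\<close> is chosen so that the
  density \<open>1 + t\<close> is nonnegative on \<open>[-1,1]\<close>, which keeps all three measures positive.
\<close>

lemma second_moment:
  assumes h: "h \<in> ell2"
  shows "(\<integral>t. t\<^sup>2 \<partial>\<mu> h) = Re (ell2_inner (T h) (T h))"
proof -
  define u where "u = (\<lambda>x. 1 * h x + (1/2) * T h x)"
  define w where "w = (\<lambda>x. 0 * h x + (1/2) * T h x)"
  have Th: "T h \<in> ell2" using h by (rule T_ell2)
  have u: "u \<in> ell2" and w: "w \<in> ell2" unfolding u_def w_def by (rule ell2_lincomb[OF h Th])+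
  interpret finite_measure "\<mu> h" by (rule finite_diagonal[OF h])
  have AE_h: "AE t in \<mu> h. 0 \<le> 1 + t" using AE_diagonal[OF h] by eventually_elim auto
  have int: "integrable (\<mu> h) (\<lambda>t. t)" "integrable (\<mu> h) (\<lambda>t. t\<^sup>2)"
    using power_integrable[OF h, of 1] power_integrable[OF h, of 2] by simp_all
  define M where "M = density (\<mu> h) (\<lambda>t. ennreal (1 + t))"
  have mass_u: "mass u B = mass h B + Re (ell2_inner h (E B (T h))) + mass w B" if B: "B \<in> sets borel" for B
  proof -
    \<comment> \<open>The value \<open>a = 1\<close> gives \<open>u\<close>, the value \<open>a = 0\<close> gives \<open>w\<close>.\<close>
    have expand: "Re (ell2_inner (\<lambda>x. of_real a * h x + (1/2) * T h x) (E B (\<lambda>x. of_real a * h x + (1/2) * T h x))) =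
        a\<^sup>2 * mass h B + a * Re (ell2_inner h (E B (T h))) + mass (T h) B / 4" for a :: real
    proof -
      have "ell2_inner (\<lambda>x. of_real a * h x + (1/2) * T h x) (E B (\<lambda>x. of_real a * h x + (1/2) * T h x)) =
          of_real (a\<^sup>2) * ell2_inner h (E B h) + of_real (a/2) * ell2_inner h (E B (T h))
          + of_real (a/2) * ell2_inner (T h) (E B h) + of_real (1/4) * ell2_inner (T h) (E B (T h))"
        using h Th B
        by (simp only: E_lincomb ell2_inner_lincomb_left ell2_inner_lincomb_right E_ell2 ell2_lincomb)
           (simp add: algebra_simps power2_eq_square)
      moreover have "Re (ell2_inner (T h) (E B h)) = Re (ell2_inner h (E B (T h)))"
        using Re_ell2_inner_commute[of "T h" "E B h"] E_self_adjoint[OF B h Th] by simp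
      ultimately show ?thesis by (simp add: mass_def)
    qed
    show ?thesis using expand[of 1] expand[of 0] by (simp add: mass_def u_def w_def)
  qed
  have M: "emeasure M B = ennreal (mass h B + Re (ell2_inner h (E B (T h))))" if B: "B \<in> sets borel" for B
  proof -
    have iB: "integrable (\<mu> h) (\<lambda>t. indicator B t * t)" "integrable (\<mu> h) (indicator B :: real \<Rightarrow> real)"
      using int(1) B by (simp_all add: integrable_real_mult_indicator mult.commute[of "indicator B _"] less_top[symmetric])
    have "emeasure M B = (\<integral>\<^sup>+t. ennreal (indicator B t + indicator B t * t) \<partial>\<mu> h)"
      unfolding M_def using B
      by (subst emeasure_density) (auto intro!: nn_integral_cong simp: indicator_def)
    also have "\<dots> = ennreal (\<integral>t. indicator B t + indicator B t * t \<partial>\<mu> h)"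
      using AE_h
      by (intro nn_integral_eq_integral Bochner_Integration.integrable_add iB)
         (auto simp: indicator_def elim!: eventually_mono)
    also have "(\<integral>t. indicator B t + indicator B t * t \<partial>\<mu> h) = mass h B + Re (ell2_inner h (E B (T h)))"
      using iB h B by (simp add: mean_on measure_diagonal)
    finally show ?thesis .
  qed
  have M_nonneg: "0 \<le> mass h B + Re (ell2_inner h (E B (T h)))" if B: "B \<in> sets borel" for B
  proof -
    have "mass h B + Re (ell2_inner h (E B (T h))) = (\<integral>t. indicator B t * (1 + t) \<partial>\<mu> h)"
      using int(1) h B by (simp add: mean_on measure_diagonal distrib_left integrable_real_mult_indicator mult.commute[of "indicator B _"] less_top[symmetric])
    also have "0 \<le> \<dots>" using AE_h by (intro integral_nonneg_AE) (auto simp: indicator_def elim!: eventually_mono)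
    finally show ?thesis .
  qed
  have "(\<integral>t. t \<partial>\<mu> u) = (\<integral>t. t \<partial>M) + (\<integral>t. t \<partial>\<mu> w)"
  proof (rule integral_measure_sum)
    show "emeasure (\<mu> u) B = emeasure M B + emeasure (\<mu> w) B" if "B \<in> sets (\<mu> u)" for B
      using that u w M M_nonneg by (simp add: emeasure_diagonal mass_u ennreal_plus mass_nonneg)
    have "integrable (\<mu> h) (\<lambda>t. (1 + t) *\<^sub>R t)"
      using Bochner_Integration.integrable_add[OF int] by (simp add: distrib_right power2_eq_square)
    then show "integrable M (\<lambda>t. t)"
      unfolding M_def using AE_h by (simp add: integrable_density)
  qed (simp_all add: M_def mean_integrable u w)
  also have "(\<integral>t. t \<partial>M) = (\<integral>t. (1 + t) *\<^sub>R t \<partial>\<mu> h)"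
    unfolding M_def using AE_h by (simp add: integral_density)
  also have "\<dots> = (\<integral>t. t \<partial>\<mu> h) + (\<integral>t. t\<^sup>2 \<partial>\<mu> h)"
    using Bochner_Integration.integral_add[OF int] by (simp add: distrib_right power2_eq_square)
  finally have sum: "(\<integral>t. t \<partial>\<mu> u) = (\<integral>t. t \<partial>\<mu> h) + (\<integral>t. t\<^sup>2 \<partial>\<mu> h) + (\<integral>t. t \<partial>\<mu> w)" .
  have mean_Re: "(\<integral>t. t \<partial>\<mu> f) = Re (ell2_inner f (T f))" if "f \<in> ell2" for f
    using mean[OF that] by simp
  have expand: "Re (ell2_inner (\<lambda>x. of_real a * h x + (1/2) * T h x) (T (\<lambda>x. of_real a * h x + (1/2) * T h x))) =
      a\<^sup>2 * Re (ell2_inner h (T h)) + a * Re (ell2_inner (T h) (T h)) + Re (ell2_inner (T h) (T (T h))) / 4" for a :: real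
  proof -
    have "ell2_inner (\<lambda>x. of_real a * h x + (1/2) * T h x) (T (\<lambda>x. of_real a * h x + (1/2) * T h x)) =
        of_real (a\<^sup>2) * ell2_inner h (T h) + of_real (a/2) * ell2_inner h (T (T h))
        + of_real (a/2) * ell2_inner (T h) (T h) + of_real (1/4) * ell2_inner (T h) (T (T h))"
      using h Th
      by (simp only: T_lincomb ell2_inner_lincomb_left ell2_inner_lincomb_right T_ell2 ell2_lincomb)
         (simp add: algebra_simps power2_eq_square)
    moreover have "ell2_inner h (T (T h)) = ell2_inner (T h) (T h)"
      using h Th by (simp add: T_self_adjoint)
    ultimately show ?thesis by simp
  qed
  show ?thesis
    using sum expand[of 1] expand[of 0] u w h by (simp add: mean_Re) (simp add: u_def w_def)
qed

text \<open>
  Apply \<open>second_moment\<close> to \<open>E A h\<close>, whose spectral measure is that of \<open>h\<close> restricted to \<open>A\<close>, and use that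
  \<open>E A\<close> commutes with \<open>T\<close>.
\<close>

lemma diagonal_T:
  assumes h: "h \<in> ell2"
  shows "\<mu> (T h) = density (\<mu> h) (\<lambda>t. ennreal (t\<^sup>2))"
proof (rule diagonal_eqI)
  fix A :: "real set" assume A: "A \<in> sets borel"
  have "mass (T h) A = (\<integral>t. indicator A t * t\<^sup>2 \<partial>\<mu> h)"
    using h A second_moment[of "E A h"]
    by (simp add: mass_eq T_ell2 E_T_commute E_ell2 integral_diagonal_E)
  moreover have "emeasure (density (\<mu> h) (\<lambda>t. ennreal (t\<^sup>2))) A = (\<integral>\<^sup>+t. ennreal (indicator A t * t\<^sup>2) \<partial>\<mu> h)"
    using A by (subst emeasure_density) (auto intro!: nn_integral_cong simp: indicator_def)
  moreover have "\<dots> = ennreal (\<integral>t. indicator A t * t\<^sup>2 \<partial>\<mu> h)"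
    using power_integrable[OF h, of 2] A
    by (intro nn_integral_eq_integral) (simp_all add: integrable_real_mult_indicator mult.commute[of "indicator A _"])
  ultimately show "emeasure (density (\<mu> h) (\<lambda>t. ennreal (t\<^sup>2))) A = ennreal (mass (T h) A)" by simp
qed (use h in \<open>simp_all add: T_ell2\<close>)

lemma T_power_ell2: "h \<in> ell2 \<Longrightarrow> (T ^^ n) h \<in> ell2"
  by (induction n) (simp_all add: T_ell2)

lemma integral_diagonal_T_power:
  fixes g :: "real \<Rightarrow> real"
  assumes h: "h \<in> ell2" and [measurable]: "g \<in> borel_measurable borel"
  shows "(\<integral>t. g t \<partial>\<mu> ((T ^^ n) h)) = (\<integral>t. t ^ (2 * n) * g t \<partial>\<mu> h)"
  using assms(2)
proof (induction n arbitrary: g)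
  case (Suc n)
  have "(\<integral>t. g t \<partial>\<mu> ((T ^^ Suc n) h)) = (\<integral>t. t\<^sup>2 * g t \<partial>\<mu> ((T ^^ n) h))"
    using Suc.prems h by (simp add: diagonal_T T_power_ell2 integral_density)
  also have "\<dots> = (\<integral>t. t ^ (2 * n) * (t\<^sup>2 * g t) \<partial>\<mu> h)"
    using Suc.prems by (intro Suc.IH) simp
  finally show ?case by (simp add: power2_eq_square mult_ac)
qed simp

lemma T_power_self_adjoint:
  "f \<in> ell2 \<Longrightarrow> g \<in> ell2 \<Longrightarrow> ell2_inner f ((T ^^ n) g) = ell2_inner ((T ^^ n) f) g"
proof (induction n arbitrary: g)
  case (Suc n)
  have "ell2_inner f ((T ^^ Suc n) g) = ell2_inner f ((T ^^ n) (T g))"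
    by (simp add: funpow_swap1)
  then show ?case using Suc by (simp add: T_ell2 T_self_adjoint T_power_ell2)
qed simp

text \<open>
  For \<open>k = 2n\<close> the moment is the total mass of the spectral measure of \<open>T\<^sup>n h\<close>, and for \<open>k = 2n + 1\<close> it
  is the mean of that measure.
\<close>

theorem moment_diagonal:
  assumes h: "h \<in> ell2"
  shows "(\<integral>t. t ^ k \<partial>\<mu> h) = Re (ell2_inner h ((T ^^ k) h))"
proof (cases "even k")
  case True
  then obtain n where k: "k = n + n" by (auto elim!: evenE simp: mult_2)
  have "(\<integral>t. t ^ k \<partial>\<mu> h) = (\<integral>t. 1 \<partial>\<mu> ((T ^^ n) h))"
    using integral_diagonal_T_power[OF h, of "\<lambda>_. 1" n] by (simp add: k mult_2)
  also have "\<dots> = Re (ell2_inner ((T ^^ n) h) ((T ^^ n) h))"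
    using h by (simp add: measure_diagonal T_power_ell2 mass_UNIV)
  also have "\<dots> = Re (ell2_inner h ((T ^^ k) h))"
    using h by (simp add: k funpow_add T_power_self_adjoint T_power_ell2)
  finally show ?thesis .
next
  case False
  then obtain n where k: "k = Suc (n + n)" by (auto elim!: oddE simp: mult_2)
  have "(\<integral>t. t ^ k \<partial>\<mu> h) = (\<integral>t. t \<partial>\<mu> ((T ^^ n) h))"
    using integral_diagonal_T_power[OF h, of "\<lambda>t. t" n] by (simp add: k mult_2 mult.commute[of _ "_ ^ _"])
  also have "\<dots> = Re (ell2_inner ((T ^^ n) h) (T ((T ^^ n) h)))"
    using h by (simp add: mean T_power_ell2)
  also have "\<dots> = Re (ell2_inner h ((T ^^ k) h))"
  proof -
    have "(T ^^ k) h = (T ^^ n) ((T ^^ Suc n) h)"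
      using k funpow_add[of n "Suc n" T] by simp
    then show ?thesis using h by (simp add: T_power_self_adjoint T_power_ell2 T_ell2)
  qed
  finally show ?thesis .
qed

end

section \<open>Simple random walk on a transitive graph\<close>

definition walk_operator :: "('v \<Rightarrow> 'v \<Rightarrow> bool) \<Rightarrow> ('v \<Rightarrow> real) \<Rightarrow> 'v \<Rightarrow> real" where
  "walk_operator adj f = (\<lambda>x. \<Sum>y | adj x y. srw adj UNIV x y * f y)"

definition return_probability :: "('v \<Rightarrow> 'v \<Rightarrow> bool) \<Rightarrow> nat \<Rightarrow> 'v \<Rightarrow> real" where
  "return_probability adj n x = (walk_operator adj ^^ n) (point_mass x) x"

text \<open>
  The vertices of \<open>W\<close> from which the walk can reach a boundary vertex in fewer than \<open>n\<close> steps. Started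
  elsewhere in \<open>W\<close>, the first \<open>n\<close> steps use only transition probabilities of interior vertices.
\<close>

fun near_boundary :: "('v \<Rightarrow> 'v \<Rightarrow> bool) \<Rightarrow> 'v set \<Rightarrow> nat \<Rightarrow> 'v set" where
  "near_boundary adj W 0 = {}"
| "near_boundary adj W (Suc n) =
    vertex_boundary adj W \<union> {x \<in> W. \<exists>y \<in> near_boundary adj W n. adj x y}"

locale transitive_graph =
  fixes adj :: "'v \<Rightarrow> 'v \<Rightarrow> bool"
  assumes simple: "simple_graph adj"
    and infinite: "infinite (UNIV :: 'v set)"
    and connected: "connected_graph adj"
    and locally_finite: "locally_finite_graph adj"
    and transitive: "vertex_transitive adj"
begin

abbreviation P :: "'v \<Rightarrow> 'v \<Rightarrow> real" where
  "P \<equiv> srw adj UNIV"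

abbreviation walk :: "('v \<Rightarrow> real) \<Rightarrow> 'v \<Rightarrow> real" where
  "walk \<equiv> walk_operator adj"

text \<open>
  By transitivity the choice of the reference vertex is immaterial; see \<open>card_neighbours\<close>.
\<close>

definition deg :: nat where
  "deg = card {y. adj undefined y}"

lemma adj_sym: "adj x y \<Longrightarrow> adj y x"
  using simple by (auto simp: simple_graph_def dest: sympD)

lemma finite_neighbours: "finite {y. adj x y}"
  using locally_finite by (simp add: locally_finite_graph_def)

lemma automorphism_neighbours:
  assumes "graph_automorphism adj \<phi>"
  shows "{y. adj (\<phi> x) y} = \<phi> ` {y. adj x y}"
proof -
  have "y \<in> \<phi> ` {y. adj x y}" if "adj (\<phi> x) y" for y
  proof -
    obtain z where "y = \<phi> z" using assms by (metis bij_pointE graph_automorphism_def)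
    then show ?thesis using that assms by (auto simp: graph_automorphism_def)
  qed
  then show ?thesis using assms by (auto simp: graph_automorphism_def)
qed

lemma automorphism_inj: "graph_automorphism adj \<phi> \<Longrightarrow> inj \<phi>"
  by (simp add: graph_automorphism_def bij_is_inj)

lemma card_neighbours: "card {y. adj x y} = deg"
proof -
  obtain \<phi> where \<phi>: "graph_automorphism adj \<phi>" "\<phi> undefined = x"
    using transitive by (auto simp: vertex_transitive_def)
  have "{y. adj x y} = \<phi> ` {y. adj undefined y}"
    using automorphism_neighbours[OF \<phi>(1), of undefined] \<phi>(2) by simp
  then show ?thesis
    using automorphism_inj[OF \<phi>(1)] by (simp add: deg_def card_image inj_on_subset)
qed

text \<open>
  A nonempty finite set without boundary vertices would be closed under adjacency, hence all of the connected
  infinite graph.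
\<close>

lemma boundary_nonempty:
  assumes "finite W" "W \<noteq> {}"
  shows "vertex_boundary adj W \<noteq> {}"
proof
  assume empty: "vertex_boundary adj W = {}"
  obtain x where x: "x \<in> W" using assms(2) by blast
  have "y \<in> W" for y
  proof -
    have "adj\<^sup>*\<^sup>* x y" using connected by (simp add: connected_graph_def)
    then show ?thesis
      by (induction rule: rtranclp_induct) (use x empty in \<open>auto simp: vertex_boundary_def\<close>)
  qed
  then have "W = UNIV" by blast
  then show False using assms(1) infinite by simp
qed

lemma deg_pos: "0 < deg"
proof -
  have "vertex_boundary adj {undefined} \<noteq> {}" by (rule boundary_nonempty) simp_all
  then have "{y. adj undefined y} \<noteq> {}" by (auto simp: vertex_boundary_def)
  then show ?thesis by (simp add: deg_def card_gt_0_iff finite_neighbours)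
qed

lemma P_eq: "P x y = (if adj x y then 1 / real deg else 0)"
  by (simp add: srw_def card_neighbours)

lemma walk_eq: "walk f x = (\<Sum>y | adj x y. f y) / real deg"
  by (simp add: walk_operator_def P_eq sum_divide_distrib)

lemma walk_power_Suc: "(walk ^^ Suc n) f x = (\<Sum>y | adj x y. (walk ^^ n) f y) / real deg"
  by (simp add: walk_eq[of "(walk ^^ n) f"])

lemma walk_power_automorphism:
  assumes \<phi>: "graph_automorphism adj \<phi>"
  shows "(walk ^^ n) (point_mass (\<phi> x)) (\<phi> y) = (walk ^^ n) (point_mass x) y"
proof (induction n arbitrary: y)
  case 0
  then show ?case using automorphism_inj[OF \<phi>] by (simp add: point_mass_def inj_eq)
next
  case (Suc n)
  have "(walk ^^ Suc n) (point_mass (\<phi> x)) (\<phi> y) =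
      (\<Sum>z\<in>\<phi> ` {z. adj y z}. (walk ^^ n) (point_mass (\<phi> x)) z) / real deg"
    by (simp only: walk_power_Suc automorphism_neighbours[OF \<phi>])
  also have "\<dots> = (\<Sum>z | adj y z. (walk ^^ n) (point_mass (\<phi> x)) (\<phi> z)) / real deg"
    using automorphism_inj[OF \<phi>] by (subst sum.reindex) (auto intro: inj_on_subset)
  finally show ?case using Suc by (simp only: walk_power_Suc)
qed

lemma return_probability_transitive: "return_probability adj n x = return_probability adj n y"
proof -
  obtain \<phi> where "graph_automorphism adj \<phi>" "\<phi> x = y"
    using transitive by (auto simp: vertex_transitive_def)
  then show ?thesis using walk_power_automorphism[of \<phi> n x x] by (simp add: return_probability_def)
qed

lemma walk_power_bounds: "0 \<le> (walk ^^ n) (point_mass x) y \<and> (walk ^^ n) (point_mass x) y \<le> 1"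
proof (induction n arbitrary: y)
  case 0
  then show ?case by (simp add: point_mass_def)
next
  case (Suc n)
  have "(\<Sum>z | adj y z. (walk ^^ n) (point_mass x) z) \<le> (\<Sum>z | adj y z. 1)"
    using Suc by (intro sum_mono) auto
  then show ?case unfolding walk_power_Suc
    using Suc deg_pos by (auto simp: card_neighbours intro!: divide_nonneg_nonneg sum_nonneg)
qed

lemma near_boundary_subset: "near_boundary adj W n \<subseteq> W"
  by (cases n) (auto simp: vertex_boundary_def)

text \<open>
  Each further step enlarges the set at most by the factor \<open>deg\<close>, and the boundary is added again.
\<close>

lemma card_near_boundary:
  assumes W: "finite W"
  shows "card (near_boundary adj W n) \<le> (\<Sum>k<n. deg ^ k) * card (vertex_boundary adj W)"
proof (induction n)
  case (Suc n)
  let ?B = "near_boundary adj W n"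
  have fin: "finite ?B" using finite_subset[OF near_boundary_subset W] .
  have "card {x \<in> W. \<exists>y\<in>?B. adj x y} \<le> card (\<Union>y\<in>?B. {x. adj y x})"
    using fin finite_neighbours by (intro card_mono) (auto intro: adj_sym)
  also have "\<dots> \<le> (\<Sum>y\<in>?B. card {x. adj y x})" by (rule card_UN_le[OF fin])
  also have "\<dots> = deg * card ?B" by (simp add: card_neighbours)
  also have "\<dots> \<le> deg * ((\<Sum>k<n. deg ^ k) * card (vertex_boundary adj W))"
    using Suc.IH by simp
  finally have "card (near_boundary adj W (Suc n)) \<le>
      card (vertex_boundary adj W) + deg * ((\<Sum>k<n. deg ^ k) * card (vertex_boundary adj W))"
    by (auto intro: order_trans[OF card_Un_le])
  also have "\<dots> = (\<Sum>k<Suc n. deg ^ k) * card (vertex_boundary adj W)"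
    by (simp only: sum.lessThan_Suc_shift) (simp add: sum_distrib_left algebra_simps)
  finally show ?case .
qed simp

text \<open>
  The first step uses an interior row of the kernel and leads to a neighbour that is still too far from the
  boundary to reach it in the remaining steps.
\<close>

lemma kernel_power_eq_walk_power:
  assumes W: "finite W"
    and interior: "\<And>x y. x \<in> W - vertex_boundary adj W \<Longrightarrow> y \<in> W \<Longrightarrow> K x y = P x y"
    and x: "x \<in> W - near_boundary adj W n"
  shows "(kernel_operator W K ^^ n) f x = (walk ^^ n) f x"
  using x
proof (induction n arbitrary: x)
  case (Suc n)
  then have x: "x \<in> W - vertex_boundary adj W" by auto
  then have nbrs: "{y. adj x y} \<subseteq> W" by (auto simp: vertex_boundary_def)
  have "(kernel_operator W K ^^ Suc n) f x = (\<Sum>y\<in>W. P x y * (kernel_operator W K ^^ n) f y)"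
    using x interior[OF x] by (simp add: kernel_operator_def)
  also have "\<dots> = (\<Sum>y | adj x y. P x y * (kernel_operator W K ^^ n) f y)"
    using W nbrs by (intro sum.mono_neutral_right) (auto simp: P_eq)
  also have "\<dots> = (\<Sum>y | adj x y. P x y * (walk ^^ n) f y)"
    using Suc nbrs by (intro sum.cong refl arg_cong2[where f = "(*)"] Suc.IH) auto
  finally show ?case by (simp add: walk_operator_def[of adj "(walk ^^ n) f"])
qed simp

lemma kernel_power_bounds:
  assumes W: "finite W"
    and nonneg: "\<And>x y. x \<in> W \<Longrightarrow> y \<in> W \<Longrightarrow> 0 \<le> K x y"
    and sub: "\<And>x. x \<in> W \<Longrightarrow> (\<Sum>y\<in>W. K x y) \<le> 1"
  shows "0 \<le> (kernel_operator W K ^^ n) (point_mass x) y \<and> (kernel_operator W K ^^ n) (point_mass x) y \<le> 1"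
proof (induction n arbitrary: y)
  case 0
  then show ?case by (simp add: point_mass_def)
next
  case (Suc n)
  let ?f = "(kernel_operator W K ^^ n) (point_mass x)"
  show ?case
  proof (cases "y \<in> W")
    case True
    have "(\<Sum>z\<in>W. K y z * ?f z) \<le> (\<Sum>z\<in>W. K y z)"
      using Suc nonneg[OF True] by (intro sum_mono mult_right_le_one_le) auto
    also have "\<dots> \<le> 1" by (rule sub[OF True])
    finally show ?thesis
      using True Suc nonneg[OF True] by (auto simp: kernel_operator_def[of W K ?f] intro!: sum_nonneg)
  qed (simp add: kernel_operator_def)
qed

text \<open>
  Only the vertices near the boundary contribute to the difference, each by at most one since both
  terms lie in \<open>[0,1]\<close>, and there are at most \<open>(\<Sum>k<n. deg ^ k) * |\<partial>W|\<close> of them.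
\<close>

lemma trace_close_to_return_probability:
  assumes W: "finite W" "W \<noteq> {}"
    and interior: "\<And>x y. x \<in> W - vertex_boundary adj W \<Longrightarrow> y \<in> W \<Longrightarrow> K x y = P x y"
    and nonneg: "\<And>x y. x \<in> W \<Longrightarrow> y \<in> W \<Longrightarrow> 0 \<le> K x y"
    and sub: "\<And>x. x \<in> W \<Longrightarrow> (\<Sum>y\<in>W. K x y) \<le> 1"
  shows "\<bar>(\<Sum>x\<in>W. (kernel_operator W K ^^ n) (point_mass x) x) / real (card W) - return_probability adj n v\<bar>
    \<le> real (\<Sum>k<n. deg ^ k) * boundary_ratio adj W"
proof -
  define d where "d = (\<lambda>x. (kernel_operator W K ^^ n) (point_mass x) x - return_probability adj n v)"
  have pos: "0 < real (card W)" using W by (simp add: card_gt_0_iff)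
  have far: "d x = 0" if x: "x \<in> W - near_boundary adj W n" for x
  proof -
    have "(kernel_operator W K ^^ n) (point_mass x) x = return_probability adj n x"
      unfolding return_probability_def
      by (rule kernel_power_eq_walk_power[OF W(1) _ x]) (rule interior)
    then show ?thesis using return_probability_transitive[of n x v] by (simp add: d_def)
  qed
  have near: "\<bar>d x\<bar> \<le> 1" for x
    using kernel_power_bounds[where W = W and K = K and n = n and x = x and y = x] W(1) nonneg sub
      walk_power_bounds[of n v v]
    by (auto simp: d_def return_probability_def abs_le_iff)
  have "\<bar>\<Sum>x\<in>W. d x\<bar> = \<bar>\<Sum>x\<in>near_boundary adj W n. d x\<bar>"
    using W(1) near_boundary_subset far by (intro arg_cong[of _ _ abs] sum.mono_neutral_right) auto
  also have "\<dots> \<le> (\<Sum>x\<in>near_boundary adj W n. 1)"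
    by (rule order_trans[OF sum_abs]) (intro sum_mono near)
  also have "\<dots> \<le> real ((\<Sum>k<n. deg ^ k) * card (vertex_boundary adj W))"
    using card_near_boundary[OF W(1), of n] by (simp only: sum_constant mult_1_right of_nat_le_iff)
  finally have bound: "\<bar>\<Sum>x\<in>W. d x\<bar> \<le> real (\<Sum>k<n. deg ^ k) * real (card (vertex_boundary adj W))"
    by simp
  have "(\<Sum>x\<in>W. (kernel_operator W K ^^ n) (point_mass x) x) / real (card W) - return_probability adj n v
      = (\<Sum>x\<in>W. d x) / real (card W)"
    using pos by (simp add: d_def sum_subtractf field_simps)
  then show ?thesis
    using bound pos by (simp add: boundary_ratio_def divide_right_mono)
qed

lemma substochastic_truncated:
  assumes W: "finite W" "W \<noteq> {}"
  shows "substochastic_kernel W P (\<lambda>_. 1)"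
proof unfold_locales
  fix x assume "x \<in> W"
  have "(\<Sum>y\<in>W. \<bar>P x y\<bar>) = (\<Sum>y\<in>W. if adj x y then 1 / real deg else 0)"
    by (intro sum.cong) (simp_all add: P_eq)
  also have "\<dots> = real (card (W \<inter> {y. adj x y})) / real deg"
    using W by (simp add: sum.If_cases)
  also have "\<dots> \<le> 1"
    using card_mono[OF finite_neighbours, of "W \<inter> {y. adj x y}" x] deg_pos by (simp add: card_neighbours)
  finally show "(\<Sum>y\<in>W. \<bar>P x y\<bar>) \<le> 1" .
qed (use W in \<open>auto simp: P_eq intro: adj_sym\<close>)

lemma substochastic_srw:
  assumes W: "finite W" "W \<noteq> {}" and no_isolated: "no_isolated adj W"
  shows "substochastic_kernel W (srw adj W) (\<lambda>x. real (card {z \<in> W. adj x z}))"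
proof unfold_locales
  have pos: "0 < card {z \<in> W. adj x z}" if "x \<in> W" for x
    using assms(1,3) that by (auto simp: no_isolated_def card_gt_0_iff)
  show "0 < real (card {z \<in> W. adj x z})" if "x \<in> W" for x using pos[OF that] by simp
  show "real (card {z \<in> W. adj x z}) * srw adj W x y = real (card {z \<in> W. adj y z}) * srw adj W y x"
    if "x \<in> W" "y \<in> W" for x y
    using pos[OF that(1)] pos[OF that(2)] by (auto simp: srw_def intro: adj_sym)
  fix x assume x: "x \<in> W"
  define c where "c = card {z \<in> W. adj x z}"
  have "(\<Sum>y\<in>W. \<bar>srw adj W x y\<bar>) = (\<Sum>y\<in>W. if adj x y then 1 / real c else 0)"
    using x by (intro sum.cong) (simp_all add: srw_def c_def)
  also have "\<dots> = real c * (1 / real c)"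
    using W by (simp add: sum.If_cases Int_def flip: c_def)
  also have "\<dots> = 1" using pos[OF x] by (simp flip: c_def)
  finally show "(\<Sum>y\<in>W. \<bar>srw adj W x y\<bar>) \<le> 1" by simp
qed (use W in auto)

lemma srw_nonneg: "0 \<le> srw adj W x y"
  by (simp add: srw_def)

lemma srw_interior:
  assumes "x \<in> W - vertex_boundary adj W" "y \<in> W"
  shows "srw adj W x y = P x y"
proof -
  have "{z \<in> W. adj x z} = {z. adj x z}" using assms by (auto simp: vertex_boundary_def)
  then show ?thesis using assms by (simp add: srw_def)
qed

text \<open>
  By convexity \<open>|P f|\<^sup>2 \<le> P |f|\<^sup>2\<close> pointwise, and summing over \<open>x\<close> preserves the total mass because every
  vertex has exactly \<open>deg\<close> neighbours.
\<close>

lemma srw_operator_contraction: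
  assumes f: "f \<in> ell2"
  shows "srw_operator adj f \<in> ell2"
    and "Re (ell2_inner (srw_operator adj f) (srw_operator adj f)) \<le> Re (ell2_inner f f)"
proof -
  define S where "S = (\<Sum>\<^sub>\<infinity>x. (cmod (f x))\<^sup>2)"
  have sum_f: "(\<lambda>x. (cmod (f x))\<^sup>2) summable_on UNIV" using f by (simp add: ell2_iff)
  have pointwise: "(cmod (srw_operator adj f x))\<^sup>2 \<le> (\<Sum>y | adj x y. (cmod (f y))\<^sup>2 / real deg)" for x
  proof -
    have "cmod (srw_operator adj f x) \<le> (\<Sum>y | adj x y. cmod (f y) / real deg)"
      unfolding srw_operator_def
      by (rule order_trans[OF norm_sum]) (intro sum_mono, simp add: P_eq norm_mult norm_divide)
    then have "(cmod (srw_operator adj f x))\<^sup>2 \<le> ((\<Sum>y | adj x y. cmod (f y)) / real deg)\<^sup>2"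
      by (intro power_mono) (simp_all add: sum_divide_distrib)
    also have "\<dots> \<le> ((\<Sum>y | adj x y. (cmod (f y))\<^sup>2) * real deg) / (real deg)\<^sup>2"
      using sum_squared_le_sum_of_squares[of "\<lambda>y. cmod (f y)" "{y. adj x y}"]
      by (simp add: power_divide card_neighbours divide_right_mono)
    also have "\<dots> = (\<Sum>y | adj x y. (cmod (f y))\<^sup>2 / real deg)"
      using deg_pos by (simp add: power2_eq_square sum_divide_distrib)
    finally show ?thesis .
  qed
  have partial: "(\<Sum>x\<in>F. (cmod (srw_operator adj f x))\<^sup>2) \<le> S" if F: "finite F" for F
  proof -
    define N where "N = (\<Union>x\<in>F. {y. adj x y})"
    have N: "finite N" using F finite_neighbours by (simp add: N_def)
    have "(\<Sum>x\<in>F. (cmod (srw_operator adj f x))\<^sup>2) \<le> (\<Sum>x\<in>F. \<Sum>y | adj x y. (cmod (f y))\<^sup>2 / real deg)"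
      by (intro sum_mono pointwise)
    also have "\<dots> = (\<Sum>x\<in>F. \<Sum>y | y \<in> N \<and> adj x y. (cmod (f y))\<^sup>2 / real deg)"
      by (intro sum.cong refl) (auto simp: N_def)
    also have "\<dots> = (\<Sum>y\<in>N. \<Sum>x | x \<in> F \<and> adj x y. (cmod (f y))\<^sup>2 / real deg)"
      by (rule sum.swap_restrict[OF F N])
    also have "\<dots> \<le> (\<Sum>y\<in>N. (cmod (f y))\<^sup>2)"
    proof (intro sum_mono)
      fix y
      have "card {x \<in> F. adj x y} \<le> card {x. adj y x}"
        using finite_neighbours by (intro card_mono) (auto intro: adj_sym)
      then have "real (card {x \<in> F. adj x y}) * ((cmod (f y))\<^sup>2 / real deg) \<le> real deg * ((cmod (f y))\<^sup>2 / real deg)"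
        by (intro mult_right_mono) (simp_all add: card_neighbours)
      then show "(\<Sum>x | x \<in> F \<and> adj x y. (cmod (f y))\<^sup>2 / real deg) \<le> (cmod (f y))\<^sup>2"
        using deg_pos by simp
    qed
    also have "\<dots> \<le> S"
      unfolding S_def using N sum_f by (intro finite_sum_le_infsum) auto
    finally show ?thesis .
  qed
  have sum_Tf: "(\<lambda>x. (cmod (srw_operator adj f x))\<^sup>2) summable_on UNIV"
    using partial by (intro nonneg_bdd_above_summable_on bdd_aboveI[of _ S]) auto
  then show "srw_operator adj f \<in> ell2" by (simp add: ell2_iff)
  show "Re (ell2_inner (srw_operator adj f) (srw_operator adj f)) \<le> Re (ell2_inner f f)"
    using infsum_le_finite_sums[OF sum_Tf partial] by (simp add: ell2_inner_self S_def)
qed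

lemma contraction_resolution_srw:
  assumes "resolution_of_identity (srw_operator adj) E"
  shows "contraction_resolution (srw_operator adj) E"
  using assms srw_operator_contraction
  by unfold_locales
     (auto simp: srw_operator_def fun_eq_iff sum.distrib sum_distrib_left algebra_simps)

lemma srw_operator_power_delta:
  "(srw_operator adj ^^ n) (delta v) x = of_real ((walk ^^ n) (point_mass v) x)"
proof (induction n arbitrary: x)
  case 0
  then show ?case by (simp add: delta_def point_mass_def)
next
  case (Suc n)
  then show ?case by (simp add: srw_operator_def[of adj "(srw_operator adj ^^ n) _"] walk_operator_def)
qed

lemma boundary_ratio_pos: "finite W \<Longrightarrow> W \<noteq> {} \<Longrightarrow> 0 < boundary_ratio adj W"
  using boundary_nonempty[of W] finite_subset[of "vertex_boundary adj W" W]
  by (auto simp: boundary_ratio_def card_gt_0_iff vertex_boundary_def intro!: divide_pos_pos)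

lemma return_probability_2: "return_probability adj 2 x = 1 / real deg"
proof -
  have "return_probability adj 2 x = (\<Sum>y | adj x y. walk (point_mass x) y) / real deg"
    by (simp add: return_probability_def numeral_2_eq_2 walk_eq[of "walk _"])
  also have "(\<Sum>y | adj x y. walk (point_mass x) y) = (\<Sum>y | adj x y. 1 / real deg)"
  proof (intro sum.cong refl)
    fix y assume "y \<in> {y. adj x y}"
    then have "(\<Sum>z | adj y z. point_mass x z) = (\<Sum>z\<in>{x}. point_mass x z)"
      using finite_neighbours by (intro sum.mono_neutral_right) (auto intro: adj_sym simp: point_mass_def)
    then show "walk (point_mass x) y = 1 / real deg" by (simp add: walk_eq point_mass_def)
  qed
  also have "\<dots> = 1" using deg_pos by (simp add: card_neighbours)
  finally show ?thesis by simp
qed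

text \<open>
  The two-step return probability of the truncated kernel at \<open>x\<close> is the number of neighbours of \<open>x\<close> in
  \<open>W\<close> divided by \<open>deg\<^sup>2\<close>, and a boundary vertex has at most \<open>deg - 1\<close> neighbours in \<open>W\<close>.
\<close>

lemma truncated_second_moment:
  assumes W: "finite W" "W \<noteq> {}"
  shows "(\<integral>t. t\<^sup>2 \<partial>truncated_spectral_measure adj W) \<le> 1 / real deg - boundary_ratio adj W / (real deg)\<^sup>2"
proof -
  interpret substochastic_kernel W P "\<lambda>_. 1" by (rule substochastic_truncated[OF W])
  let ?b = "\<lambda>x. if x \<in> vertex_boundary adj W then 1 else 0 :: real"
  have diag: "(oper ^^ 2) (point_mass x) x \<le> (real deg - ?b x) / (real deg)\<^sup>2" if x: "x \<in> W" for x
  proof -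
    have oper_point: "oper (point_mass x) y = P y x" if "y \<in> W" for y
      using W x that by (simp add: kernel_operator_def point_mass_def if_distrib cong: if_cong)
    have "(oper ^^ 2) (point_mass x) x = (\<Sum>y\<in>W. P x y * P y x)"
      using x oper_point by (simp add: numeral_2_eq_2 kernel_operator_def[of W P "oper _"])
    also have "\<dots> = (\<Sum>y\<in>W. if adj x y then 1 / (real deg)\<^sup>2 else 0)"
      by (intro sum.cong) (auto simp: P_eq power2_eq_square intro: adj_sym)
    also have "\<dots> = real (card (W \<inter> {y. adj x y})) / (real deg)\<^sup>2"
      using W by (simp add: sum.If_cases)
    also have "real (card (W \<inter> {y. adj x y})) \<le> real deg - ?b x"
    proof (cases "x \<in> vertex_boundary adj W")
      case True
      then have "W \<inter> {y. adj x y} \<subset> {y. adj x y}" by (auto simp: vertex_boundary_def)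
      then have "card (W \<inter> {y. adj x y}) < card {y. adj x y}"
        using finite_neighbours by (rule psubset_card_mono[rotated])
      then show ?thesis using True by (simp add: card_neighbours)
    next
      case False
      then show ?thesis
        using card_mono[OF finite_neighbours, of "W \<inter> {y. adj x y}" x] by (simp add: card_neighbours)
    qed
    finally show ?thesis by (simp add: divide_right_mono)
  qed
  have "(\<Sum>x\<in>W. (oper ^^ 2) (point_mass x) x) \<le> (\<Sum>x\<in>W. (real deg - ?b x) / (real deg)\<^sup>2)"
    by (intro sum_mono diag)
  also have "\<dots> = (real (card W) * real deg - (\<Sum>x\<in>W. ?b x)) / (real deg)\<^sup>2"
    by (simp add: sum_divide_distrib[symmetric] sum_subtractf)
  also have "(\<Sum>x\<in>W. ?b x) = real (card (vertex_boundary adj W))"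
    using W by (simp add: sum.If_cases) (rule arg_cong[of _ _ card], auto simp: vertex_boundary_def)
  finally have "(\<integral>t. t\<^sup>2 \<partial>truncated_spectral_measure adj W) \<le>
      ((real (card W) * real deg - real (card (vertex_boundary adj W))) / (real deg)\<^sup>2) / real (card W)"
    unfolding truncated_spectral_measure_def moment_cumulative_measure
    using card_W_pos by (intro divide_right_mono) auto
  also have "\<dots> = 1 / real deg - boundary_ratio adj W / (real deg)\<^sup>2"
    using card_W_pos deg_pos by (simp add: boundary_ratio_def field_simps power2_eq_square)
  finally show ?thesis .
qed

end

section \<open>Spectral measures along Folner and expanding sequences\<close>

locale resolved_walk = transitive_graph adj
  for adj :: "'v \<Rightarrow> 'v \<Rightarrow> bool" +
  fixes E :: "real set \<Rightarrow> ('v \<Rightarrow> complex) \<Rightarrow> 'v \<Rightarrow> complex" and v :: 'v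
  assumes resolution: "resolution_of_identity (srw_operator adj) E"
begin

sublocale resolution: contraction_resolution "srw_operator adj" E
  by (rule contraction_resolution_srw[OF resolution])

lemma real_distribution_plancherel: "real_distribution (plancherel_measure E v)"
proof -
  have "prob_space (plancherel_measure E v)"
    unfolding plancherel_measure_def
    by (rule prob_spaceI)
       (simp add: resolution.emeasure_diagonal delta_ell2 resolution.mass_UNIV ell2_inner_delta, simp add: delta_def)
  then show ?thesis
    by (simp add: real_distribution_def real_distribution_axioms_def plancherel_measure_def)
qed

lemma AE_plancherel: "AE t in plancherel_measure E v. \<bar>t\<bar> \<le> 1"
  unfolding plancherel_measure_def by (rule resolution.AE_diagonal[OF delta_ell2])

lemma moment_plancherel: "(\<integral>t. t ^ k \<partial>plancherel_measure E v) = return_probability adj k v"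
  by (simp add: plancherel_measure_def resolution.moment_diagonal delta_ell2 ell2_inner_delta
      srw_operator_power_delta return_probability_def)

text \<open>
  Covers simple random walk on the subgraphs and the truncated kernel at once: both agree
  with the infinite walk at interior vertices, which is what makes the moments converge.
\<close>

lemma weak_conv_cumulative:
  fixes Y :: "nat \<Rightarrow> 'v set" and K :: "nat \<Rightarrow> 'v \<Rightarrow> 'v \<Rightarrow> real"
  assumes ratio: "(\<lambda>n. boundary_ratio adj (Y n)) \<longlonglongrightarrow> 0"
    and K: "\<And>n. substochastic_kernel (Y n) (K n) (m n)"
    and nonneg: "\<And>n x y. 0 \<le> K n x y"
    and interior: "\<And>n x y. x \<in> Y n - vertex_boundary adj (Y n) \<Longrightarrow> y \<in> Y n \<Longrightarrow> K n x y = P x y"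
  shows "weak_conv_m (\<lambda>n. cumulative_measure (Y n) (K n)) (plancherel_measure E v)"
proof (rule weak_conv_from_moments)
  fix k
  interpret substochastic_kernel "Y n" "K n" "m n" for n by (rule K)
  show "real_distribution (cumulative_measure (Y n) (K n))" for n
    by (rule real_distribution_cumulative_measure)
  show "AE t in cumulative_measure (Y n) (K n). \<bar>t\<bar> \<le> 1" for n
    by (rule AE_cumulative_measure)
  have bound: "norm ((\<integral>t. t ^ k \<partial>cumulative_measure (Y n) (K n)) - return_probability adj k v)
      \<le> real (\<Sum>j<k. deg ^ j) * boundary_ratio adj (Y n)" for n
    unfolding moment_cumulative_measure real_norm_def
    using row_sum nonneg
    by (intro trace_close_to_return_probability finite_W W_nonempty interior) auto
  have "(\<lambda>n. real (\<Sum>j<k. deg ^ j) * boundary_ratio adj (Y n)) \<longlonglongrightarrow> 0"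
    using tendsto_mult_right_zero[OF ratio] .
  then have "(\<lambda>n. (\<integral>t. t ^ k \<partial>cumulative_measure (Y n) (K n)) - return_probability adj k v) \<longlonglongrightarrow> 0"
    by (rule Lim_null_comparison[rotated]) (intro always_eventually allI bound)
  then show "(\<lambda>n. \<integral>t. t ^ k \<partial>cumulative_measure (Y n) (K n)) \<longlonglongrightarrow> (\<integral>t. t ^ k \<partial>plancherel_measure E v)"
    unfolding moment_plancherel by (simp add: LIM_zero_iff)
qed (rule real_distribution_plancherel AE_plancherel)+

lemma weak_conv_srw:
  assumes "\<And>n. finite (Y n)" "\<And>n. Y n \<noteq> {}" "\<And>n. no_isolated adj (Y n)"
    and "(\<lambda>n. boundary_ratio adj (Y n)) \<longlonglongrightarrow> 0"
  shows "weak_conv_m (\<lambda>n. srw_spectral_measure adj (Y n)) (plancherel_measure E v)"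
  unfolding srw_spectral_measure_def
  by (rule weak_conv_cumulative[OF assms(4) substochastic_srw[OF assms(1-3)] srw_nonneg srw_interior])

lemma weak_conv_truncated:
  assumes "\<And>n. finite (Y n)" "\<And>n. Y n \<noteq> {}"
    and "(\<lambda>n. boundary_ratio adj (Y n)) \<longlonglongrightarrow> 0"
  shows "weak_conv_m (\<lambda>n. truncated_spectral_measure adj (Y n)) (plancherel_measure E v)"
  unfolding truncated_spectral_measure_def
  by (rule weak_conv_cumulative[OF assms(3) substochastic_truncated[OF assms(1-2)] srw_nonneg refl])

lemma expanding_not_weak_conv:
  assumes Y: "\<And>n. finite (Y n)" "\<And>n. Y n \<noteq> {}"
    and expanding: "0 < c" "\<And>n. c \<le> boundary_ratio adj (Y n)"
  shows "\<not> weak_conv_m (\<lambda>n. truncated_spectral_measure adj (Y n)) (plancherel_measure E v)"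
proof
  assume conv: "weak_conv_m (\<lambda>n. truncated_spectral_measure adj (Y n)) (plancherel_measure E v)"
  interpret substochastic_kernel "Y n" P "\<lambda>_. 1" for n by (rule substochastic_truncated[OF Y])
  have "(\<lambda>n. \<integral>t. t\<^sup>2 \<partial>truncated_spectral_measure adj (Y n)) \<longlonglongrightarrow> (\<integral>t. t\<^sup>2 \<partial>plancherel_measure E v)"
    using conv real_distribution_cumulative_measure AE_cumulative_measure
      real_distribution_plancherel AE_plancherel
    unfolding truncated_spectral_measure_def by (intro second_moment_weak_conv)
  moreover have "(\<integral>t. t\<^sup>2 \<partial>truncated_spectral_measure adj (Y n)) \<le> 1 / real deg - c / (real deg)\<^sup>2" for n
    using truncated_second_moment[OF Y, of n] divide_right_mono[OF expanding(2)[of n], of "(real deg)\<^sup>2"]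
    by simp
  ultimately have "1 / real deg \<le> 1 / real deg - c / (real deg)\<^sup>2"
    using LIMSEQ_le_const2 unfolding moment_plancherel return_probability_2 by blast
  moreover have "0 < c / (real deg)\<^sup>2" using expanding(1) deg_pos by simp
  ultimately show False by linarith
qed

end

text \<open>
  Infinitely many terms lie below any positive bound, because finitely many positive terms are bounded away
  from zero. For boundary ratios positivity holds by \<open>boundary_ratio_pos\<close>.
\<close>

lemma subsequence_to_unattained_Inf:
  fixes a :: "nat \<Rightarrow> real"
  assumes pos: "\<And>n. 0 < a n" and inf: "(INF n. a n) = 0"
  shows "\<exists>r. strict_mono r \<and> (\<lambda>n. a (r n)) \<longlonglongrightarrow> 0"
proof -
  have later: "\<exists>n>N. a n < 1 / real (Suc N)" for N
  proof -
    define e where "e = min (1 / real (Suc N)) (Min (a ` {..N}))"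
    have "Min (a ` {..N}) \<in> a ` {..N}" by (intro Min_in) auto
    then have e: "0 < e" "e \<le> 1 / real (Suc N)" using pos by (auto simp: e_def)
    have e_le: "e \<le> a n" if "n \<le> N" for n
      unfolding e_def using that by (intro min.coboundedI2 Min_le) auto
    have "bdd_below (range a)" using pos by (intro bdd_belowI[of _ 0]) (auto intro: less_imp_le)
    then obtain n where "a n < e" using e(1) inf cINF_less_iff[of UNIV a e] by auto
    then have "n > N" using e_le[of n] by (meson not_le)
    then show ?thesis using \<open>a n < e\<close> e(2) by force
  qed
  have "\<exists>r. \<forall>n. True \<and> (r n < r (Suc n) \<and> a (r (Suc n)) < 1 / real (Suc (r n)))"
    using dependent_nat_choice[of "\<lambda>_ _. True" "\<lambda>_ x y. x < y \<and> a y < 1 / real (Suc x)"] later by auto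
  then obtain r where r: "\<And>n. r n < r (Suc n)" "\<And>n. a (r (Suc n)) < 1 / real (Suc (r n))" by blast
  have mono: "strict_mono r" using r(1) by (simp add: strict_mono_Suc_iff)
  have "a (r (Suc n)) \<le> 1 / real (Suc n)" for n
  proof -
    have "1 / real (Suc (r n)) \<le> 1 / real (Suc n)"
      using strict_mono_imp_increasing[OF mono, of n] by (intro divide_left_mono) auto
    then show ?thesis using r(2)[of n] by linarith
  qed
  then have "(\<lambda>n. a (r (Suc n))) \<longlonglongrightarrow> 0"
    using pos
    by (intro Lim_null_comparison[OF _ LIMSEQ_inverse_real_of_nat] always_eventually)
       (auto simp: inverse_eq_divide less_imp_le)
  then have "(\<lambda>n. a (r n)) \<longlonglongrightarrow> 0" by (rule LIMSEQ_imp_Suc)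
  then show ?thesis using mono by blast
qed

theorem theorem6p3:
  fixes adj :: "'v \<Rightarrow> 'v \<Rightarrow> bool"
    and X :: "nat \<Rightarrow> 'v set"
    and E :: "real set \<Rightarrow> ('v \<Rightarrow> complex) \<Rightarrow> ('v \<Rightarrow> complex)"
    and v :: 'v
  assumes "simple_graph adj"
    and "infinite (UNIV :: 'v set)"
    and "connected_graph adj"
    and "locally_finite_graph adj"
    and "vertex_transitive adj"
    and "incseq X"
    and "\<And>n. finite (X n)"
    and "\<And>n. X n \<noteq> {}"
    and "(\<Union>n. X n) = UNIV"
    and "resolution_of_identity (srw_operator adj) E"
  shows
    "((\<lambda>n. boundary_ratio adj (X n)) \<longlonglongrightarrow> 0 \<longrightarrow>
        ((\<forall>n. no_isolated adj (X n)) \<longrightarrow>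
           weak_conv_m (\<lambda>n. srw_spectral_measure adj (X n)) (plancherel_measure E v)) \<and>
        weak_conv_m (\<lambda>n. truncated_spectral_measure adj (X n)) (plancherel_measure E v))
     \<and>
     ((INF n. boundary_ratio adj (X n)) = 0 \<longrightarrow>
        (\<exists>r. strict_mono r \<and> (\<lambda>n. boundary_ratio adj (X (r n))) \<longlonglongrightarrow> 0 \<and>
           ((\<forall>n. no_isolated adj (X n)) \<longrightarrow>
              weak_conv_m (\<lambda>n. srw_spectral_measure adj (X (r n))) (plancherel_measure E v)) \<and>
           weak_conv_m (\<lambda>n. truncated_spectral_measure adj (X (r n))) (plancherel_measure E v)))
     \<and>
     ((INF n. boundary_ratio adj (X n)) > 0 \<longrightarrow>
        \<not> weak_conv_m (\<lambda>n. truncated_spectral_measure adj (X n)) (plancherel_measure E v))"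
proof (intro conjI impI)
  interpret resolved_walk adj E v using assms(1-5,10) by unfold_locales
  note fin = assms(7) and ne = assms(8)
  {
    assume ratio: "(\<lambda>n. boundary_ratio adj (X n)) \<longlonglongrightarrow> 0"
    show "weak_conv_m (\<lambda>n. srw_spectral_measure adj (X n)) (plancherel_measure E v)"
      if "\<forall>n. no_isolated adj (X n)"
      using that by (intro weak_conv_srw[OF fin ne _ ratio]) simp
    show "weak_conv_m (\<lambda>n. truncated_spectral_measure adj (X n)) (plancherel_measure E v)"
      by (rule weak_conv_truncated[OF fin ne ratio])
  }
  show "\<exists>r. strict_mono r \<and> (\<lambda>n. boundary_ratio adj (X (r n))) \<longlonglongrightarrow> 0 \<and>
      ((\<forall>n. no_isolated adj (X n)) \<longrightarrow>
         weak_conv_m (\<lambda>n. srw_spectral_measure adj (X (r n))) (plancherel_measure E v)) \<and>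
      weak_conv_m (\<lambda>n. truncated_spectral_measure adj (X (r n))) (plancherel_measure E v)"
    if inf: "(INF n. boundary_ratio adj (X n)) = 0"
  proof -
    obtain r where "strict_mono r" and ratio: "(\<lambda>n. boundary_ratio adj (X (r n))) \<longlonglongrightarrow> 0"
      using subsequence_to_unattained_Inf[of "\<lambda>n. boundary_ratio adj (X n)"] boundary_ratio_pos[OF fin ne] inf by blast
    moreover have "weak_conv_m (\<lambda>n. srw_spectral_measure adj (X (r n))) (plancherel_measure E v)"
      if "\<forall>n. no_isolated adj (X n)"
      using that by (intro weak_conv_srw[OF fin ne _ ratio]) simp
    moreover have "weak_conv_m (\<lambda>n. truncated_spectral_measure adj (X (r n))) (plancherel_measure E v)"
      by (rule weak_conv_truncated[OF fin ne ratio])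
    ultimately show ?thesis by blast
  qed
  show "\<not> weak_conv_m (\<lambda>n. truncated_spectral_measure adj (X n)) (plancherel_measure E v)"
    if "(INF n. boundary_ratio adj (X n)) > 0"
  proof (rule expanding_not_weak_conv[OF fin ne that])
    have "bdd_below (range (\<lambda>n. boundary_ratio adj (X n)))"
      by (intro bdd_belowI[of _ 0]) (auto simp: boundary_ratio_def)
    then show "(INF n. boundary_ratio adj (X n)) \<le> boundary_ratio adj (X n)" for n
      by (rule cINF_lower) simp
  qed
qed

end
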